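(* Let $G$ be a torsion free nilpotent relatively free group, and let $\sqrt{G}$ be its Mal'tsev completion. Then $G$ and $\sqrt{G}$ are geometrically equivalent.
   Context: A relatively free group here means a group which is free in some subvariety of the variety of nilpotent groups of class (at most) $s$, for some $s\in\mathbb{N}$. Geometric equivalence. Let $\Theta$ be a variety of groups and, for a finite set $X$, let $W(X)$ be the free group of $\Theta$ over $X$. For $G\in\Theta$ and $T\subset W(X)$ put $T'_G=\{\mu\in \mathrm{Hom}(W(X),G)\mid T\subset\ker\mu\}$ and $T''_G=\bigcap_{\mu\in T'_G}\ker\mu\subset W(X)$. Groups $G_1,G_2\in\Theta$ are geometrically equivalent ($G_1\sim G_2$) if $T''_{G_1}=T''_{G_2}$ for every finite set $X$ and every $T\subset W(X)$. (It is known that $G_1\sim G_2$ if and only if every finitely generated subgroup $H$ of $G_1$ is approximated by $G_2$, i.e. there is a family $\{\varphi_i\}_{i\in I}\subset\mathrm{Hom}(H,G_2)$ with $\bigcap_{i}\ker\varphi_i=\{1\}$, and vice versa; so the notion does not depend on the variety $\Theta$ containing both groups.) Mal'tsev completion. For a torsion free nilpotent group $G$, $\sqrt{G}$ is the minimal torsion free nilpotent group containing $G$ such that for every $x\in\sqrt{G}$ and every $n\in\mathbb{N}$, $n\ge 1$, there is a (unique) $x^{1/n}\in\sqrt{G}$ with $(x^{1/n})^n=x$. It is nilpotent of the same class as $G$. *)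

theory Defs
  imports "HOL-Algebra.Generated_Groups" "HOL-Algebra.Coset"
begin

section \<open>Free groups\<close>

text \<open>
  A letter \<open>(x, True)\<close> stands for the generator \<open>x\<close>, and \<open>(x, False)\<close> for its inverse.
  The free group over \<open>X\<close> consists of the reduced words in the letters over \<open>X\<close>.
\<close>

type_synonym 'x letter = "'x \<times> bool"
type_synonym 'x word = "'x letter list"

definition inv_letter :: "'x letter \<Rightarrow> 'x letter" where
  "inv_letter a = (fst a, \<not> snd a)"

definition reduced :: "'x word \<Rightarrow> bool" where
  "reduced w \<longleftrightarrow> successively (\<lambda>a b. b \<noteq> inv_letter a) w"

fun push :: "'x letter \<Rightarrow> 'x word \<Rightarrow> 'x word" where
  "push a [] = [a]"
| "push a (b # w) = (if b = inv_letter a then w else a # b # w)"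

definition free_group :: "'x set \<Rightarrow> 'x word monoid" where
  "free_group X =
     \<lparr>carrier = {w. reduced w \<and> fst ` set w \<subseteq> X}, mult = foldr push, one = []\<rparr>"

definition gen :: "'x \<Rightarrow> 'x word" where
  "gen x = [(x, True)]"

lemma inv_letter_simps [simp]:
  "inv_letter (inv_letter a) = a" "inv_letter a \<noteq> a" "a \<noteq> inv_letter a"
  "fst (inv_letter a) = fst a"
  by (auto simp: inv_letter_def prod_eq_iff)

lemma reduced_Nil [simp]: "reduced []"
  by (simp add: reduced_def)

lemma reduced_Cons:
  "reduced (a # w) \<longleftrightarrow> (w = [] \<or> hd w \<noteq> inv_letter a) \<and> reduced w"
  by (cases w) (auto simp: reduced_def)

lemma reduced_push: "reduced w \<Longrightarrow> reduced (push a w)"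
  by (cases w) (auto simp: reduced_Cons)

lemma reduced_foldr: "reduced w \<Longrightarrow> reduced (foldr push u w)"
  by (induction u) (auto intro: reduced_push)

lemma push_inv: "reduced w \<Longrightarrow> push a (push (inv_letter a) w) = w"
  by (cases w) (auto simp: reduced_Cons split: list.splits, case_tac list, auto)

lemma push_inv': "reduced w \<Longrightarrow> push (inv_letter a) (push a w) = w"
  using push_inv[of w "inv_letter a"] by simp

lemma foldr_push_push:
  "reduced w \<Longrightarrow> foldr push (push a v) w = push a (foldr push v w)"
  by (cases v) (auto simp: push_inv reduced_foldr)

lemma foldr_push_assoc:
  "reduced w \<Longrightarrow> foldr push (foldr push u v) w = foldr push u (foldr push v w)"
  by (induction u) (auto simp: foldr_push_push)

lemma foldr_push_Nil: "reduced w \<Longrightarrow> foldr push w [] = w"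
proof (induction w)
  case (Cons a w)
  then show ?case by (cases w) (auto simp: reduced_Cons)
qed simp

lemma set_push: "fst ` set (push a w) \<subseteq> insert (fst a) (fst ` set w)"
  by (cases w) auto

lemma set_foldr: "fst ` set (foldr push u v) \<subseteq> fst ` set u \<union> fst ` set v"
proof (induction u)
  case (Cons a u)
  then show ?case using set_push[of a "foldr push u v"] by simp blast
qed simp

lemma foldr_push_inverse:
  "reduced w \<Longrightarrow> foldr push (foldr push (rev (map inv_letter u)) []) (foldr push u w) = w"
proof (induction u arbitrary: w)
  case (Cons a u)
  have "foldr push (foldr push (rev (map inv_letter (a # u))) []) (foldr push (a # u) w)
      = foldr push (rev (map inv_letter u) @ [inv_letter a]) (push a (foldr push u w))"
    using Cons.prems by (subst foldr_push_assoc) (auto intro: reduced_push reduced_foldr)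
  also have "\<dots> = foldr push (rev (map inv_letter u)) (foldr push u w)"
    using Cons.prems by (simp add: push_inv' reduced_foldr)
  also have "\<dots> = foldr push (foldr push (rev (map inv_letter u)) []) (foldr push u w)"
    using Cons.prems by (subst foldr_push_assoc) (auto intro: reduced_foldr)
  finally show ?case using Cons by simp
qed simp

lemma free_group_simps:
  "w \<in> carrier (free_group X) \<longleftrightarrow> reduced w \<and> fst ` set w \<subseteq> X"
  "u \<otimes>\<^bsub>free_group X\<^esub> v = foldr push u v"
  "\<one>\<^bsub>free_group X\<^esub> = []"
  by (simp_all add: free_group_def)

lemma free_group_mult_closed:
  assumes "reduced u \<and> fst ` set u \<subseteq> X" "reduced v \<and> fst ` set v \<subseteq> X"
  shows "reduced (foldr push u v) \<and> fst ` set (foldr push u v) \<subseteq> X"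
  using assms set_foldr[of u v] reduced_foldr[of v u] by (meson order_trans Un_least)

lemma free_group_left_inverse:
  assumes u: "u \<in> carrier (free_group X)"
  shows "\<exists>v\<in>carrier (free_group X). v \<otimes>\<^bsub>free_group X\<^esub> u = \<one>\<^bsub>free_group X\<^esub>"
proof (rule bexI)
  let ?v = "foldr push (rev (map inv_letter u)) []"
  show "?v \<otimes>\<^bsub>free_group X\<^esub> u = \<one>\<^bsub>free_group X\<^esub>"
    using u foldr_push_inverse[of "[]" u] foldr_push_Nil[of u] by (simp add: free_group_simps)
  have "fst ` set ?v \<subseteq> fst ` set u"
    using set_foldr[of "rev (map inv_letter u)" "[]"] by (simp add: image_image)
  then show "?v \<in> carrier (free_group X)"
    using u by (auto simp only: free_group_simps intro: reduced_foldr reduced_Nil)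
qed

lemma group_free_group: "group (free_group X)"
proof (rule groupI, goal_cases)
  case (1 u v)
  then show ?case unfolding free_group_simps by (rule free_group_mult_closed)
next
  case 2
  show ?case by (simp add: free_group_simps)
next
  case (3 u v w)
  then show ?case unfolding free_group_simps by (intro foldr_push_assoc) simp
next
  case (4 u)
  show ?case by (simp add: free_group_simps)
next
  case (5 u)
  then show ?case by (rule free_group_left_inverse)
qed

lemma gen_in_carrier: "x \<in> X \<Longrightarrow> gen x \<in> carrier (free_group X)"
  by (simp add: gen_def free_group_def reduced_def)

fun letter_value :: "('a, 'm) monoid_scheme \<Rightarrow> ('x \<Rightarrow> 'a) \<Rightarrow> 'x letter \<Rightarrow> 'a" where
  "letter_value H f (x, b) = (if b then f x else inv\<^bsub>H\<^esub> f x)"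

definition word_value :: "('a, 'm) monoid_scheme \<Rightarrow> ('x \<Rightarrow> 'a) \<Rightarrow> 'x word \<Rightarrow> 'a" where
  "word_value H f w = foldr (\<lambda>a y. letter_value H f a \<otimes>\<^bsub>H\<^esub> y) w \<one>\<^bsub>H\<^esub>"

context
  fixes H :: "('a, 'm) monoid_scheme" and f :: "'x \<Rightarrow> 'a" and X :: "'x set"
  assumes H: "group H" and f: "f \<in> X \<rightarrow> carrier H"
begin

interpretation H: group H by (rule H)

lemma letter_value_closed: "fst a \<in> X \<Longrightarrow> letter_value H f a \<in> carrier H"
  using f by (cases a) auto

lemma word_value_closed: "fst ` set w \<subseteq> X \<Longrightarrow> word_value H f w \<in> carrier H"
  by (induction w) (auto simp: word_value_def intro!: letter_value_closed)

lemma letter_value_inv: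
  "fst a \<in> X \<Longrightarrow> letter_value H f (inv_letter a) = inv\<^bsub>H\<^esub> letter_value H f a"
  using f by (cases a) (auto simp: inv_letter_def Pi_iff)

lemma word_value_push:
  assumes "fst a \<in> X" "fst ` set w \<subseteq> X"
  shows "word_value H f (push a w) = letter_value H f a \<otimes>\<^bsub>H\<^esub> word_value H f w"
proof (cases w)
  case (Cons b v)
  have "word_value H f v \<in> carrier H" using assms Cons by (intro word_value_closed) auto
  then show ?thesis using assms Cons
    by (auto simp: word_value_def letter_value_closed letter_value_inv H.m_assoc[symmetric])
qed (auto simp: word_value_def)

lemma word_value_foldr:
  assumes "fst ` set u \<subseteq> X" "fst ` set v \<subseteq> X"
  shows "word_value H f (foldr push u v) = word_value H f u \<otimes>\<^bsub>H\<^esub> word_value H f v"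
  using assms
proof (induction u)
  case Nil
  then show ?case using word_value_closed[of v] by (simp add: word_value_def)
next
  case (Cons a u)
  have "fst ` set (foldr push u v) \<subseteq> X" using Cons.prems by (intro order_trans[OF set_foldr]) simp
  moreover have "word_value H f (a # u) = letter_value H f a \<otimes>\<^bsub>H\<^esub> word_value H f u"
    by (simp add: word_value_def)
  ultimately show ?case using Cons
    by (simp add: word_value_push H.m_assoc letter_value_closed word_value_closed)
qed

lemma word_value_hom: "word_value H f \<in> hom (free_group X) H"
  by (rule homI) (auto simp: free_group_def word_value_foldr intro!: word_value_closed)

lemma word_value_gen: "x \<in> X \<Longrightarrow> word_value H f (gen x) = f x"
  using f by (auto simp: word_value_def gen_def Pi_iff)

lemma free_group_hom_unique:
  assumes \<phi>: "\<phi> \<in> hom (free_group X) H" and eq: "\<And>x. x \<in> X \<Longrightarrow> \<phi> (gen x) = f x"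
    and w: "w \<in> carrier (free_group X)"
  shows "\<phi> w = word_value H f w"
  using w
proof (induction w)
  case Nil
  interpret \<phi>: group_hom "free_group X" H \<phi>
    using \<phi> H group_free_group by (simp add: group_hom_def group_hom_axioms_def)
  show ?case using \<phi>.hom_one by (simp add: free_group_def word_value_def)
next
  case (Cons a w)
  interpret \<phi>: group_hom "free_group X" H \<phi>
    using \<phi> H group_free_group by (simp add: group_hom_def group_hom_axioms_def)
  obtain x b where a: "a = (x, b)" by force
  have x: "x \<in> X" and w: "w \<in> carrier (free_group X)"
    using Cons.prems a by (auto simp: free_group_def reduced_Cons)
  have ac: "[a] \<in> carrier (free_group X)"
    using x a by (simp add: free_group_def reduced_Cons)
  have "a # w = [a] \<otimes>\<^bsub>free_group X\<^esub> w"
    using Cons.prems by (cases w) (auto simp: free_group_def reduced_Cons)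
  then have "\<phi> (a # w) = \<phi> [a] \<otimes>\<^bsub>H\<^esub> \<phi> w" using ac w by simp
  moreover have "\<phi> [a] = letter_value H f a"
  proof (cases b)
    case True
    then show ?thesis using a eq[OF x] by (simp add: gen_def)
  next
    case False
    have "inv\<^bsub>free_group X\<^esub> (gen x) = [a]"
      using ac gen_in_carrier[OF x] False a
      by (intro group.inv_equality[OF group_free_group])
         (auto simp: free_group_def gen_def inv_letter_def)
    then have "\<phi> [a] = inv\<^bsub>H\<^esub> \<phi> (gen x)"
      using gen_in_carrier[OF x] by (metis \<phi>.hom_inv)
    then show ?thesis using False a eq[OF x] by simp
  qed
  ultimately show ?case using Cons.IH[OF w] by (simp add: word_value_def)
qed

end


section \<open>Varieties of groups and their relatively free groups\<close>

text \<open>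
  A variety is given by a set of laws: elements of the free group on countably many generators.
  A group belongs to it if every homomorphism from that free group kills all laws.
\<close>

abbreviation free_nat :: "nat word monoid" where
  "free_nat \<equiv> free_group UNIV"

definition laws :: "nat word set \<Rightarrow> bool" where
  "laws V \<longleftrightarrow> V \<subseteq> carrier free_nat"

definition in_variety :: "nat word set \<Rightarrow> ('a, 'm) monoid_scheme \<Rightarrow> bool" where
  "in_variety V G \<longleftrightarrow> group G \<and> (\<forall>\<phi>\<in>hom free_nat G. \<forall>v\<in>V. \<phi> v = \<one>\<^bsub>G\<^esub>)"

definition verbal_subgroup :: "nat word set \<Rightarrow> ('a, 'm) monoid_scheme \<Rightarrow> 'a set" where
  "verbal_subgroup V G = generate G {\<phi> v | \<phi> v. \<phi> \<in> hom free_nat G \<and> v \<in> V}"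

text \<open>
  \<open>variety_free V X\<close> is the free group over \<open>X\<close> of the variety \<open>V\<close>;
  see \<open>variety_free_in_variety\<close> and \<open>variety_free_universal\<close> below.
\<close>

definition variety_free :: "nat word set \<Rightarrow> 'x set \<Rightarrow> 'x word set monoid" where
  "variety_free V X = free_group X Mod verbal_subgroup V (free_group X)"

definition variety_gen :: "nat word set \<Rightarrow> 'x set \<Rightarrow> 'x \<Rightarrow> 'x word set" where
  "variety_gen V X x = verbal_subgroup V (free_group X) #>\<^bsub>free_group X\<^esub> gen x"

text \<open>
  The consequences of the laws \<open>V\<close> form the verbal subgroup of the free group on countably many
  generators, so the variety \<open>V\<close> is contained in the variety \<open>U\<close> iff that subgroup contains \<open>U\<close>;
  see \<open>subvariety_iff\<close> and \<open>subvariety_in_variety\<close>.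
\<close>

definition subvariety :: "nat word set \<Rightarrow> nat word set \<Rightarrow> bool" where
  "subvariety V U \<longleftrightarrow> U \<subseteq> verbal_subgroup V free_nat"

lemma verbal_values_in_carrier:
  assumes "laws V"
  shows "{\<phi> v | \<phi> v. \<phi> \<in> hom free_nat G \<and> v \<in> V} \<subseteq> carrier G"
  using assms by (auto simp: laws_def hom_def)

lemma verbal_normal:
  assumes "laws V" "group G"
  shows "normal (verbal_subgroup V G) G"
proof -
  interpret group G by fact
  show ?thesis unfolding verbal_subgroup_def
  proof (rule normal_generateI[OF verbal_values_in_carrier[OF assms(1)]])
    fix h g
    assume h: "h \<in> {\<phi> v | \<phi> v. \<phi> \<in> hom free_nat G \<and> v \<in> V}" and g: "g \<in> carrier G"
    then obtain \<phi> v where hv: "h = \<phi> v" "\<phi> \<in> hom free_nat G" "v \<in> V" by blast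
    have cl: "\<phi> x \<in> carrier G" if "x \<in> carrier free_nat" for x
      using hv(2) that by (auto simp: hom_def)
    have "(\<lambda>x. g \<otimes>\<^bsub>G\<^esub> \<phi> x \<otimes>\<^bsub>G\<^esub> inv\<^bsub>G\<^esub> g) \<in> hom free_nat G"
    proof (rule homI)
      fix x y assume xy: "x \<in> carrier free_nat" "y \<in> carrier free_nat"
      have "inv\<^bsub>G\<^esub> g \<otimes>\<^bsub>G\<^esub> (g \<otimes>\<^bsub>G\<^esub> z) = z" if "z \<in> carrier G" for z
        using g that by (simp add: m_assoc[symmetric])
      then show "g \<otimes>\<^bsub>G\<^esub> \<phi> (x \<otimes>\<^bsub>free_nat\<^esub> y) \<otimes>\<^bsub>G\<^esub> inv\<^bsub>G\<^esub> g
          = g \<otimes>\<^bsub>G\<^esub> \<phi> x \<otimes>\<^bsub>G\<^esub> inv\<^bsub>G\<^esub> g \<otimes>\<^bsub>G\<^esub> (g \<otimes>\<^bsub>G\<^esub> \<phi> y \<otimes>\<^bsub>G\<^esub> inv\<^bsub>G\<^esub> g)"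
        using g xy cl hom_mult[OF hv(2)] by (simp add: m_assoc)
    qed (use g cl in auto)
    then show "g \<otimes>\<^bsub>G\<^esub> h \<otimes>\<^bsub>G\<^esub> inv\<^bsub>G\<^esub> g \<in> {\<phi> v | \<phi> v. \<phi> \<in> hom free_nat G \<and> v \<in> V}"
      using hv by (intro CollectI exI[of _ "\<lambda>x. g \<otimes>\<^bsub>G\<^esub> \<phi> x \<otimes>\<^bsub>G\<^esub> inv\<^bsub>G\<^esub> g"] exI[of _ v]) auto
  qed
qed

lemma free_group_lift:
  fixes X :: "'x set"
  assumes p: "\<pi> \<in> hom G Q" "carrier Q \<subseteq> \<pi> ` carrier G" and "group G" "group Q"
    and \<phi>: "\<phi> \<in> hom (free_group X) Q"
  shows "\<exists>\<psi>\<in>hom (free_group X) G. \<forall>w\<in>carrier (free_group X). \<pi> (\<psi> w) = \<phi> w"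
proof -
  have "\<exists>y. y \<in> carrier G \<and> \<pi> y = \<phi> (gen x)" if "x \<in> X" for x
  proof -
    have "\<phi> (gen x) \<in> carrier Q" using gen_in_carrier[OF that] \<phi> by (auto simp: hom_def)
    then show ?thesis using p(2) by fastforce
  qed
  then obtain f where f: "\<And>x. x \<in> X \<Longrightarrow> f x \<in> carrier G \<and> \<pi> (f x) = \<phi> (gen x)"
    by metis
  let ?\<psi> = "word_value G f"
  have fX: "f \<in> X \<rightarrow> carrier G" using f by auto
  have \<psi>: "?\<psi> \<in> hom (free_group X) G" by (rule word_value_hom[OF \<open>group G\<close> fX])
  have g: "(\<lambda>x. \<phi> (gen x)) \<in> X \<rightarrow> carrier Q"
    using gen_in_carrier[of _ X] \<phi> by (auto simp: hom_def)
  have c: "\<pi> \<circ> ?\<psi> \<in> hom (free_group X) Q" using Group.hom_compose[OF \<psi> p(1)] by (simp add: o_def)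
  have "\<pi> (?\<psi> w) = \<phi> w" if "w \<in> carrier (free_group X)" for w
  proof -
    have "(\<pi> \<circ> ?\<psi>) (gen x) = \<phi> (gen x)" if "x \<in> X" for x
      using f[OF that] word_value_gen[OF \<open>group G\<close> fX that] by simp
    then have "(\<pi> \<circ> ?\<psi>) w = word_value Q (\<lambda>x. \<phi> (gen x)) w"
      by (intro free_group_hom_unique[OF \<open>group Q\<close> g c _ that])
    then show ?thesis using free_group_hom_unique[OF \<open>group Q\<close> g \<phi> refl that] by simp
  qed
  then show ?thesis using \<psi> by blast
qed

lemma variety_free_group: "laws V \<Longrightarrow> group (variety_free V X)"
  unfolding variety_free_def by (intro normal.factorgroup_is_group verbal_normal group_free_group)

lemma variety_free_in_variety:
  fixes X :: "'x set"
  assumes "laws V"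
  shows "in_variety V (variety_free V X)"
  unfolding in_variety_def
proof (intro conjI ballI)
  let ?F = "free_group X" and ?N = "verbal_subgroup V (free_group X)"
  interpret N: normal ?N ?F by (rule verbal_normal[OF assms group_free_group])
  fix \<phi> v assume \<phi>: "\<phi> \<in> hom free_nat (variety_free V X)" and v: "v \<in> V"
  have "(\<lambda>a. ?N #>\<^bsub>?F\<^esub> a) \<in> hom ?F (variety_free V X)"
    unfolding variety_free_def by (rule N.r_coset_hom_Mod)
  moreover have "carrier (variety_free V X) \<subseteq> (\<lambda>a. ?N #>\<^bsub>?F\<^esub> a) ` carrier ?F"
    by (simp add: variety_free_def carrier_FactGroup)
  ultimately obtain \<psi> where \<psi>: "\<psi> \<in> hom free_nat ?F"
    "\<forall>w\<in>carrier free_nat. ?N #>\<^bsub>?F\<^esub> \<psi> w = \<phi> w"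
    by (rule bexE[OF free_group_lift[OF _ _ group_free_group variety_free_group[OF assms] \<phi>]])
  have "\<psi> v \<in> ?N" unfolding verbal_subgroup_def
    using \<psi>(1) v by (intro generate.incl CollectI exI[of _ \<psi>] exI[of _ v]) simp
  then have "?N #>\<^bsub>?F\<^esub> \<psi> v = ?N"
    by (rule N.rcos_const[OF group_free_group])
  then show "\<phi> v = \<one>\<^bsub>variety_free V X\<^esub>"
    using \<psi>(2) subsetD[OF assms[unfolded laws_def] v] by (simp add: variety_free_def)
qed (rule variety_free_group[OF assms])

lemma verbal_subgroup_in_kernel:
  assumes "laws V" "group G" "in_variety V H" "\<phi> \<in> hom G H"
  shows "verbal_subgroup V G \<subseteq> kernel G H \<phi>"
proof -
  interpret group_hom G H \<phi>
    using assms by (simp add: group_hom_def group_hom_axioms_def in_variety_def)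
  have "\<phi> (\<psi> v) = \<one>\<^bsub>H\<^esub>" if "\<psi> \<in> hom free_nat G" "v \<in> V" for \<psi> v
    using assms(3) Group.hom_compose[OF that(1) assms(4)] that(2) by (auto simp: in_variety_def o_def)
  then show ?thesis unfolding verbal_subgroup_def
    using subsetD[OF verbal_values_in_carrier[OF assms(1), of G]]
    by (intro G.generate_subgroup_incl[OF _ subgroup_kernel] subsetI) (auto simp: kernel_def)
qed

lemma variety_free_universal:
  fixes X :: "'x set"
  assumes "laws V" "in_variety V H" "f \<in> X \<rightarrow> carrier H"
  shows "\<exists>\<phi>\<in>hom (variety_free V X) H. (\<forall>x\<in>X. \<phi> (variety_gen V X x) = f x) \<and>
    (\<forall>\<psi>\<in>hom (variety_free V X) H. (\<forall>x\<in>X. \<psi> (variety_gen V X x) = f x) \<longrightarrow>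
       (\<forall>w\<in>carrier (variety_free V X). \<psi> w = \<phi> w))"
proof -
  let ?F = "free_group X" and ?N = "verbal_subgroup V (free_group X)"
  have H: "group H" using assms(2) by (simp add: in_variety_def)
  interpret N: normal ?N ?F by (rule verbal_normal[OF assms(1) group_free_group])
  have h: "word_value H f \<in> hom ?F H" by (rule word_value_hom[OF H assms(3)])
  interpret h: group_hom ?F H "word_value H f"
    using h H group_free_group by (simp add: group_hom_def group_hom_axioms_def)
  have ker: "?N \<subseteq> kernel ?F H (word_value H f)"
    by (rule verbal_subgroup_in_kernel[OF assms(1) group_free_group assms(2) h])
  have cong: "word_value H f a = word_value H f b"
    if "a \<in> carrier ?F" "b \<in> carrier ?F" "?N #>\<^bsub>?F\<^esub> a = ?N #>\<^bsub>?F\<^esub> b" for a b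
  proof -
    have "a \<in> ?N #>\<^bsub>?F\<^esub> b"
      using that N.rcos_self[OF that(1) N.subgroup_axioms] by auto
    then obtain n where "n \<in> ?N" "a = n \<otimes>\<^bsub>?F\<^esub> b" by (auto simp: r_coset_def)
    then show ?thesis using ker that by (auto simp: kernel_def)
  qed
  obtain \<phi> where \<phi>: "\<phi> \<in> hom (?F Mod ?N) H"
    "\<And>a. a \<in> carrier ?F \<Longrightarrow> \<phi> (?N #>\<^bsub>?F\<^esub> a) = word_value H f a"
    using FactGroup_universal[OF h N.normal_axioms cong] by metis
  show ?thesis
  proof (intro bexI[of _ \<phi>] conjI ballI impI)
    fix x assume "x \<in> X"
    then show "\<phi> (variety_gen V X x) = f x"
      using \<phi>(2)[OF gen_in_carrier] word_value_gen[OF H assms(3)] by (simp add: variety_gen_def)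
  next
    fix \<psi> w
    assume \<psi>: "\<psi> \<in> hom (variety_free V X) H" "\<forall>x\<in>X. \<psi> (variety_gen V X x) = f x"
      and w: "w \<in> carrier (variety_free V X)"
    obtain u where u: "u \<in> carrier ?F" "w = ?N #>\<^bsub>?F\<^esub> u"
      using w by (auto simp: variety_free_def carrier_FactGroup)
    have "\<psi> \<circ> (\<lambda>a. ?N #>\<^bsub>?F\<^esub> a) \<in> hom ?F H"
      using Group.hom_compose[OF N.r_coset_hom_Mod \<psi>(1)[unfolded variety_free_def]] by (simp add: o_def)
    from free_group_hom_unique[OF H assms(3) this _ u(1)]
    show "\<psi> w = \<phi> w" using \<phi>(2) u \<psi>(2) by (simp add: variety_gen_def)
  qed (use \<phi>(1) in \<open>simp add: variety_free_def\<close>)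
qed

lemma subvariety_in_variety:
  assumes "laws V" "subvariety V U" "in_variety V G"
  shows "in_variety U G"
  using assms verbal_subgroup_in_kernel[OF assms(1) group_free_group assms(3)]
  by (fastforce simp: in_variety_def subvariety_def kernel_def)

lemma subvariety_iff:
  assumes "laws V" "laws U"
  shows "subvariety V U \<longleftrightarrow> in_variety U (variety_free V (UNIV :: nat set))"
proof
  assume "subvariety V U"
  then show "in_variety U (variety_free V (UNIV :: nat set))"
    using assms(1) variety_free_in_variety subvariety_in_variety by blast
next
  let ?N = "verbal_subgroup V free_nat"
  interpret N: normal ?N free_nat by (rule verbal_normal[OF assms(1) group_free_group])
  assume U: "in_variety U (variety_free V (UNIV :: nat set))"
  have "u \<in> ?N" if u: "u \<in> U" for u
  proof -
    have "?N #>\<^bsub>free_nat\<^esub> u = ?N"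
      using U u N.r_coset_hom_Mod by (auto simp: in_variety_def variety_free_def)
    moreover have "u \<in> carrier free_nat" using u assms(2) by (auto simp: laws_def)
    ultimately show ?thesis using N.rcos_self N.subgroup_axioms by blast
  qed
  then show "subvariety V U" by (auto simp: subvariety_def)
qed


section \<open>Nilpotent groups\<close>

text \<open>\<open>lower_central G n\<close> is the term usually written with index \<open>n + 1\<close>.\<close>

fun lower_central :: "('a, 'm) monoid_scheme \<Rightarrow> nat \<Rightarrow> 'a set" where
  "lower_central G 0 = carrier G"
| "lower_central G (Suc n) =
     generate G {x \<otimes>\<^bsub>G\<^esub> y \<otimes>\<^bsub>G\<^esub> inv\<^bsub>G\<^esub> x \<otimes>\<^bsub>G\<^esub> inv\<^bsub>G\<^esub> y | x y. x \<in> lower_central G n \<and> y \<in> carrier G}"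

definition nilpotent_of_class_le :: "nat \<Rightarrow> ('a, 'm) monoid_scheme \<Rightarrow> bool" where
  "nilpotent_of_class_le s G \<longleftrightarrow> group G \<and> lower_central G s = {\<one>\<^bsub>G\<^esub>}"

definition nilpotent :: "('a, 'm) monoid_scheme \<Rightarrow> bool" where
  "nilpotent G \<longleftrightarrow> (\<exists>s. nilpotent_of_class_le s G)"

definition torsion_free :: "('a, 'm) monoid_scheme \<Rightarrow> bool" where
  "torsion_free G \<longleftrightarrow>
     (\<forall>x\<in>carrier G. \<forall>n::nat. n \<ge> 1 \<longrightarrow> x [^]\<^bsub>G\<^esub> n = \<one>\<^bsub>G\<^esub> \<longrightarrow> x = \<one>\<^bsub>G\<^esub>)"

text \<open>
  Laws for the variety of nilpotent groups of class at most \<open>s\<close>;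
  see \<open>in_variety_nilpotent_laws\<close>.
\<close>

definition nilpotent_laws :: "nat \<Rightarrow> nat word set" where
  "nilpotent_laws s = lower_central free_nat s"

lemma lower_central_subgroup:
  assumes "group G" shows "subgroup (lower_central G n) G"
proof (induction n)
  case 0
  show ?case using assms by (simp add: group.subgroup_self)
next
  case (Suc n)
  interpret group G by fact
  show ?case
    using subgroup.subset[OF Suc] by (auto intro!: generate_is_subgroup)
qed

lemma laws_nilpotent_laws: "laws (nilpotent_laws s)"
  unfolding laws_def nilpotent_laws_def
  by (intro subgroup.subset lower_central_subgroup group_free_group)

lemma lower_central_hom:
  assumes "group G" "group H" "\<phi> \<in> hom G H"
  shows "\<phi> ` lower_central G n \<subseteq> lower_central H n"
proof (induction n)
  case 0
  show ?case using assms by (auto simp: hom_def)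
next
  case (Suc n)
  interpret group_hom G H \<phi> using assms by (simp add: group_hom_def group_hom_axioms_def)
  have L: "lower_central G n \<subseteq> carrier G"
    by (rule subgroup.subset[OF lower_central_subgroup[OF assms(1)]])
  let ?C = "{x \<otimes>\<^bsub>G\<^esub> y \<otimes>\<^bsub>G\<^esub> inv\<^bsub>G\<^esub> x \<otimes>\<^bsub>G\<^esub> inv\<^bsub>G\<^esub> y | x y. x \<in> lower_central G n \<and> y \<in> carrier G}"
  let ?D = "{x \<otimes>\<^bsub>H\<^esub> y \<otimes>\<^bsub>H\<^esub> inv\<^bsub>H\<^esub> x \<otimes>\<^bsub>H\<^esub> inv\<^bsub>H\<^esub> y | x y. x \<in> lower_central H n \<and> y \<in> carrier H}"
  have C: "?C \<subseteq> carrier G" using L by auto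
  have "\<phi> ` ?C \<subseteq> ?D"
  proof (clarify)
    fix x y assume xy: "x \<in> lower_central G n" "y \<in> carrier G"
    then have "\<phi> (x \<otimes>\<^bsub>G\<^esub> y \<otimes>\<^bsub>G\<^esub> inv\<^bsub>G\<^esub> x \<otimes>\<^bsub>G\<^esub> inv\<^bsub>G\<^esub> y)
        = \<phi> x \<otimes>\<^bsub>H\<^esub> \<phi> y \<otimes>\<^bsub>H\<^esub> inv\<^bsub>H\<^esub> \<phi> x \<otimes>\<^bsub>H\<^esub> inv\<^bsub>H\<^esub> \<phi> y"
      using L by (simp add: subset_iff)
    moreover have "\<phi> x \<in> lower_central H n" "\<phi> y \<in> carrier H" using Suc xy by auto
    ultimately show "\<exists>x' y'. \<phi> (x \<otimes>\<^bsub>G\<^esub> y \<otimes>\<^bsub>G\<^esub> inv\<^bsub>G\<^esub> x \<otimes>\<^bsub>G\<^esub> inv\<^bsub>G\<^esub> y)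
        = x' \<otimes>\<^bsub>H\<^esub> y' \<otimes>\<^bsub>H\<^esub> inv\<^bsub>H\<^esub> x' \<otimes>\<^bsub>H\<^esub> inv\<^bsub>H\<^esub> y' \<and> x' \<in> lower_central H n \<and> y' \<in> carrier H"
      by blast
  qed
  then show ?case using generate_img[OF C] H.mono_generate[of "\<phi> ` ?C" ?D] by simp
qed

text \<open>Two homomorphisms from the free group are combined by splitting the generators by parity.\<close>

lemma free_nat_pair:
  assumes "group G" "\<phi>\<^sub>1 \<in> hom free_nat G" "\<phi>\<^sub>2 \<in> hom free_nat G"
  obtains \<phi> e\<^sub>1 e\<^sub>2 where "\<phi> \<in> hom free_nat G" "e\<^sub>1 \<in> hom free_nat free_nat"
    "e\<^sub>2 \<in> hom free_nat free_nat"
    "\<And>w. w \<in> carrier free_nat \<Longrightarrow> \<phi> (e\<^sub>1 w) = \<phi>\<^sub>1 w"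
    "\<And>w. w \<in> carrier free_nat \<Longrightarrow> \<phi> (e\<^sub>2 w) = \<phi>\<^sub>2 w"
proof -
  have gen: "gen n \<in> carrier free_nat" for n by (simp add: gen_in_carrier)
  define f where "f n = (if even n then \<phi>\<^sub>1 (gen (n div 2)) else \<phi>\<^sub>2 (gen (n div 2)))" for n
  have f: "f \<in> UNIV \<rightarrow> carrier G"
    using hom_in_carrier[OF assms(2) gen] hom_in_carrier[OF assms(3) gen] by (auto simp: f_def)
  have \<phi>: "word_value G f \<in> hom free_nat G" by (rule word_value_hom[OF assms(1) f])
  have *: "\<exists>e\<in>hom free_nat free_nat. \<forall>w\<in>carrier free_nat. word_value G f (e w) = \<psi> w"
    if \<psi>: "\<psi> \<in> hom free_nat G" and k: "\<And>n. f (k n) = \<psi> (gen n)" for k \<psi>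
  proof -
    have g: "(\<lambda>n. gen (k n)) \<in> UNIV \<rightarrow> carrier free_nat" using gen by auto
    let ?e = "word_value free_nat (\<lambda>n. gen (k n))"
    have e: "?e \<in> hom free_nat free_nat" by (rule word_value_hom[OF group_free_group g])
    have c: "word_value G f \<circ> ?e \<in> hom free_nat G"
      using Group.hom_compose[OF e \<phi>] by (simp add: o_def)
    have h: "(\<lambda>n. \<psi> (gen n)) \<in> UNIV \<rightarrow> carrier G" using hom_in_carrier[OF \<psi> gen] by auto
    have "word_value G f (?e w) = \<psi> w" if "w \<in> carrier free_nat" for w
      using free_group_hom_unique[OF assms(1) h c _ that]
        free_group_hom_unique[OF assms(1) h \<psi> _ that]
        word_value_gen[OF group_free_group g] word_value_gen[OF assms(1) f] k by simp
    then show ?thesis using e by blast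
  qed
  have "f (2 * n) = \<phi>\<^sub>1 (gen n)" "f (2 * n + 1) = \<phi>\<^sub>2 (gen n)" for n by (simp_all add: f_def)
  then show ?thesis
    using *[OF assms(2), of "\<lambda>n. 2 * n"] *[OF assms(3), of "\<lambda>n. 2 * n + 1"] that[OF \<phi>] by blast
qed

lemma lower_central_lift:
  assumes "group G" "g \<in> lower_central G n"
  shows "\<exists>\<phi>\<in>hom free_nat G. g \<in> \<phi> ` lower_central free_nat n"
  using assms(2)
proof (induction n arbitrary: g)
  case 0
  then have f: "(\<lambda>_. g) \<in> (UNIV :: nat set) \<rightarrow> carrier G" by simp
  have "word_value G (\<lambda>_. g) (gen (0::nat)) = g" using word_value_gen[OF assms(1) f] by simp
  then show ?case
    using word_value_hom[OF assms(1) f] gen_in_carrier[of "0::nat" UNIV]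
    by (intro bexI[of _ "word_value G (\<lambda>_. g)"]) (auto intro: rev_image_eqI)
next
  case (Suc n)
  interpret group G by fact
  interpret F: group free_nat by (rule group_free_group)
  have LF: "lower_central free_nat k \<subseteq> carrier free_nat" for k
    by (rule subgroup.subset[OF lower_central_subgroup[OF group_free_group]])
  note sub = lower_central_subgroup[OF group_free_group]
  have incl: "x \<otimes>\<^bsub>free_nat\<^esub> y \<otimes>\<^bsub>free_nat\<^esub> inv\<^bsub>free_nat\<^esub> x \<otimes>\<^bsub>free_nat\<^esub> inv\<^bsub>free_nat\<^esub> y
      \<in> lower_central free_nat (Suc n)"
    if "x \<in> lower_central free_nat n" "y \<in> carrier free_nat" for x y
    using that by (auto intro!: generate.incl)
  have comm: "\<exists>\<phi>\<in>hom free_nat G.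
      x \<otimes>\<^bsub>G\<^esub> y \<otimes>\<^bsub>G\<^esub> inv\<^bsub>G\<^esub> x \<otimes>\<^bsub>G\<^esub> inv\<^bsub>G\<^esub> y \<in> \<phi> ` lower_central free_nat (Suc n)"
    if x: "x \<in> lower_central G n" and y: "y \<in> carrier G" for x y
  proof -
    obtain \<phi>\<^sub>1 u where 1: "\<phi>\<^sub>1 \<in> hom free_nat G" "u \<in> lower_central free_nat n" "x = \<phi>\<^sub>1 u"
      using Suc.IH[OF x] by blast
    have f: "(\<lambda>_. y) \<in> (UNIV :: nat set) \<rightarrow> carrier G" using y by simp
    note 2 = word_value_hom[OF assms(1) f] word_value_gen[OF assms(1) f, of 0, simplified]
    obtain \<phi> e\<^sub>1 e\<^sub>2 where \<phi>: "\<phi> \<in> hom free_nat G" "e\<^sub>1 \<in> hom free_nat free_nat"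
      "e\<^sub>2 \<in> hom free_nat free_nat"
      "\<And>w. w \<in> carrier free_nat \<Longrightarrow> \<phi> (e\<^sub>1 w) = \<phi>\<^sub>1 w"
      "\<And>w. w \<in> carrier free_nat \<Longrightarrow> \<phi> (e\<^sub>2 w) = word_value G (\<lambda>_. y) w"
      using free_nat_pair[OF assms(1) 1(1) 2(1)] by metis
    interpret \<phi>: group_hom free_nat G \<phi>
      using \<phi>(1) by (simp add: group_hom_def group_hom_axioms_def assms(1) group_free_group)
    have g0: "gen 0 \<in> carrier free_nat" by (simp add: gen_in_carrier)
    let ?u = "e\<^sub>1 u" and ?v = "e\<^sub>2 (gen 0)"
    have u: "?u \<in> lower_central free_nat n"
      using lower_central_hom[OF group_free_group group_free_group \<phi>(2)] 1(2) by blast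
    have v: "?v \<in> carrier free_nat" using \<phi>(3) g0 by (rule hom_in_carrier)
    have "\<phi> ?u = x" "\<phi> ?v = y" using \<phi>(4,5) 1 2 g0 LF by auto
    then have "x \<otimes>\<^bsub>G\<^esub> y \<otimes>\<^bsub>G\<^esub> inv\<^bsub>G\<^esub> x \<otimes>\<^bsub>G\<^esub> inv\<^bsub>G\<^esub> y
      = \<phi> (?u \<otimes>\<^bsub>free_nat\<^esub> ?v \<otimes>\<^bsub>free_nat\<^esub> inv\<^bsub>free_nat\<^esub> ?u \<otimes>\<^bsub>free_nat\<^esub> inv\<^bsub>free_nat\<^esub> ?v)"
      using subsetD[OF LF u] v by simp
    then show ?thesis using incl[OF u v] \<phi>(1) by blast
  qed
  have inv_lift: "\<exists>\<phi>\<in>hom free_nat G. inv\<^bsub>G\<^esub> h \<in> \<phi> ` lower_central free_nat (Suc n)"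
    if h: "\<exists>\<phi>\<in>hom free_nat G. h \<in> \<phi> ` lower_central free_nat (Suc n)" for h
  proof -
    obtain \<phi> w where \<phi>: "\<phi> \<in> hom free_nat G" "w \<in> lower_central free_nat (Suc n)" "h = \<phi> w"
      using h by blast
    interpret \<phi>: group_hom free_nat G \<phi>
      using \<phi>(1) by (simp add: group_hom_def group_hom_axioms_def assms(1) group_free_group)
    have "inv\<^bsub>G\<^esub> h = \<phi> (inv\<^bsub>free_nat\<^esub> w)" using \<phi> subsetD[OF LF \<phi>(2)] by simp
    then show ?thesis using \<phi> subgroup.m_inv_closed[OF sub \<phi>(2)] by blast
  qed
  have mult: "\<exists>\<phi>\<in>hom free_nat G. h\<^sub>1 \<otimes>\<^bsub>G\<^esub> h\<^sub>2 \<in> \<phi> ` lower_central free_nat (Suc n)"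
    if h: "\<exists>\<phi>\<in>hom free_nat G. h\<^sub>1 \<in> \<phi> ` lower_central free_nat (Suc n)"
      "\<exists>\<phi>\<in>hom free_nat G. h\<^sub>2 \<in> \<phi> ` lower_central free_nat (Suc n)" for h\<^sub>1 h\<^sub>2
  proof -
    obtain \<phi>\<^sub>1 u where 1: "\<phi>\<^sub>1 \<in> hom free_nat G" "u \<in> lower_central free_nat (Suc n)" "h\<^sub>1 = \<phi>\<^sub>1 u"
      using h(1) by blast
    obtain \<phi>\<^sub>2 v where 2: "\<phi>\<^sub>2 \<in> hom free_nat G" "v \<in> lower_central free_nat (Suc n)" "h\<^sub>2 = \<phi>\<^sub>2 v"
      using h(2) by blast
    obtain \<phi> e\<^sub>1 e\<^sub>2 where \<phi>: "\<phi> \<in> hom free_nat G" "e\<^sub>1 \<in> hom free_nat free_nat"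
      "e\<^sub>2 \<in> hom free_nat free_nat"
      "\<And>w. w \<in> carrier free_nat \<Longrightarrow> \<phi> (e\<^sub>1 w) = \<phi>\<^sub>1 w"
      "\<And>w. w \<in> carrier free_nat \<Longrightarrow> \<phi> (e\<^sub>2 w) = \<phi>\<^sub>2 w"
      using free_nat_pair[OF assms(1) 1(1) 2(1)] by metis
    have uv: "e\<^sub>1 u \<in> lower_central free_nat (Suc n)" "e\<^sub>2 v \<in> lower_central free_nat (Suc n)"
      using lower_central_hom[OF group_free_group group_free_group] \<phi>(2,3) 1(2) 2(2) by blast+
    have "h\<^sub>1 \<otimes>\<^bsub>G\<^esub> h\<^sub>2 = \<phi> (e\<^sub>1 u \<otimes>\<^bsub>free_nat\<^esub> e\<^sub>2 v)"
      using hom_mult[OF \<phi>(1) subsetD[OF LF uv(1)] subsetD[OF LF uv(2)]]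
        \<phi>(4)[OF subsetD[OF LF 1(2)]] \<phi>(5)[OF subsetD[OF LF 2(2)]] 1(3) 2(3) by simp
    then show ?thesis using \<phi>(1) subgroup.m_closed[OF sub uv] by blast
  qed
  have "g \<in> generate G {x \<otimes>\<^bsub>G\<^esub> y \<otimes>\<^bsub>G\<^esub> inv\<^bsub>G\<^esub> x \<otimes>\<^bsub>G\<^esub> inv\<^bsub>G\<^esub> y | x y.
      x \<in> lower_central G n \<and> y \<in> carrier G}" using Suc.prems by simp
  then show ?case
  proof (induction rule: generate.induct)
    case one
    have "(\<lambda>_. \<one>\<^bsub>G\<^esub>) \<in> hom free_nat G" by (rule homI) auto
    then show ?case using subgroup.one_closed[OF sub, of UNIV "Suc n"]
      by (intro bexI[of _ "\<lambda>_. \<one>\<^bsub>G\<^esub>"] image_eqI[OF refl])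
  next
    case (incl h)
    then show ?case using comm by blast
  next
    case (inv h)
    then show ?case using comm inv_lift by blast
  next
    case (eng h1 h2)
    then show ?case using mult by blast
  qed
qed

lemma in_variety_nilpotent_laws:
  "in_variety (nilpotent_laws s) G \<longleftrightarrow> nilpotent_of_class_le s G"
proof (cases "group G")
  case True
  have one: "\<one>\<^bsub>G\<^esub> \<in> lower_central G s"
    by (rule subgroup.one_closed[OF lower_central_subgroup[OF True]])
  show ?thesis
  proof
    assume V: "in_variety (nilpotent_laws s) G"
    have "g = \<one>\<^bsub>G\<^esub>" if g: "g \<in> lower_central G s" for g
    proof -
      obtain \<phi> where \<phi>: "\<phi> \<in> hom free_nat G" "g \<in> \<phi> ` lower_central free_nat s"
        by (rule bexE[OF lower_central_lift[OF True g]])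
      then show ?thesis using V by (auto simp: in_variety_def nilpotent_laws_def)
    qed
    then show "nilpotent_of_class_le s G"
      using one True unfolding nilpotent_of_class_le_def by blast
  next
    assume "nilpotent_of_class_le s G"
    then have L: "lower_central G s = {\<one>\<^bsub>G\<^esub>}" by (simp add: nilpotent_of_class_le_def)
    have "\<phi> v = \<one>\<^bsub>G\<^esub>" if \<phi>: "\<phi> \<in> hom free_nat G" and v: "v \<in> nilpotent_laws s" for \<phi> v
    proof -
      have "\<phi> v \<in> lower_central G s"
        using lower_central_hom[OF group_free_group True \<phi>] imageI[OF v, of \<phi>]
        unfolding nilpotent_laws_def by (rule subsetD)
      then show ?thesis using L by simp
    qed
    then show "in_variety (nilpotent_laws s) G"
      using True by (simp add: in_variety_def)
  qed
qed (simp add: in_variety_def nilpotent_of_class_le_def)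

text \<open>
  Nothing is lost by taking the free generators from the carrier type: unless \<open>G\<close> is trivial,
  a free generating set embeds in its carrier, and the trivial group is free on the empty set.
\<close>

definition relatively_free :: "'a monoid \<Rightarrow> bool" where
  "relatively_free G \<longleftrightarrow>
     (\<exists>s V. laws V \<and> subvariety V (nilpotent_laws s) \<and> (\<exists>X :: 'a set. G \<cong> variety_free V X))"


section \<open>Mal'tsev completion\<close>

definition torsion_free_nilpotent_with_roots :: "'a monoid \<Rightarrow> bool" where
  "torsion_free_nilpotent_with_roots R \<longleftrightarrow>
     group R \<and> nilpotent R \<and> torsion_free R \<and>
     (\<forall>x\<in>carrier R. \<forall>n::nat. n \<ge> 1 \<longrightarrow> (\<exists>!y. y \<in> carrier R \<and> y [^]\<^bsub>R\<^esub> n = x))"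

text \<open>The inclusion of \<open>G\<close> in its completion \<open>R\<close> is an arbitrary embedding \<open>\<iota>\<close>.\<close>

definition maltsev_completion :: "'a monoid \<Rightarrow> 'b monoid \<Rightarrow> ('a \<Rightarrow> 'b) \<Rightarrow> bool" where
  "maltsev_completion G R \<iota> \<longleftrightarrow>
     \<iota> \<in> mon G R \<and> torsion_free_nilpotent_with_roots R \<and>
     (\<forall>S. subgroup S R \<and> \<iota> ` carrier G \<subseteq> S \<and>
          torsion_free_nilpotent_with_roots (R\<lparr>carrier := S\<rparr>) \<longrightarrow> S = carrier R)"


section \<open>Geometric equivalence\<close>

text \<open>
  \<open>alg_points \<Theta> X T G\<close> and \<open>alg_closure \<Theta> X T G\<close> are \<open>T'\<close> and \<open>T''\<close> with respect to \<open>G\<close>.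
  Homomorphisms that agree on the carrier of the free group are not identified in \<open>hom\<close>, which
  does not affect \<open>T''\<close>.
\<close>

definition alg_points ::
    "nat word set \<Rightarrow> 'x set \<Rightarrow> 'x word set set \<Rightarrow> 'a monoid \<Rightarrow> ('x word set \<Rightarrow> 'a) set" where
  "alg_points \<Theta> X T G =
     {\<mu> \<in> hom (variety_free \<Theta> X) G. T \<subseteq> kernel (variety_free \<Theta> X) G \<mu>}"

definition alg_closure ::
    "nat word set \<Rightarrow> 'x set \<Rightarrow> 'x word set set \<Rightarrow> 'a monoid \<Rightarrow> 'x word set set" where
  "alg_closure \<Theta> X T G = (\<Inter>\<mu>\<in>alg_points \<Theta> X T G. kernel (variety_free \<Theta> X) G \<mu>)"

text \<open>Finite subsets of \<open>nat\<close> represent all finite sets up to bijection.\<close>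

definition geometrically_equivalent ::
    "nat word set \<Rightarrow> 'a monoid \<Rightarrow> 'b monoid \<Rightarrow> bool" where
  "geometrically_equivalent \<Theta> G\<^sub>1 G\<^sub>2 \<longleftrightarrow>
     in_variety \<Theta> G\<^sub>1 \<and> in_variety \<Theta> G\<^sub>2 \<and>
     (\<forall>X :: nat set. finite X \<longrightarrow>
        (\<forall>T. T \<subseteq> carrier (variety_free \<Theta> X) \<longrightarrow>
           alg_closure \<Theta> X T G\<^sub>1 = alg_closure \<Theta> X T G\<^sub>2))"

end

theory Submission
  imports Defs
begin

text \<open>
  The endomorphism of \<open>G\<close> that raises the free generators to the \<open>m\<close>-th power extends to \<open>\<surd>G\<close>,
  where it acts on the \<open>n\<close>-th section of the lower central series as the \<open>m\<^sup>n\<close>-th power. Since the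
  sections of \<open>\<surd>G\<close> are torsion free, it is injective. Every element of \<open>\<surd>G\<close> has a power in \<open>G\<close>, so
  descending the series one finds a composition of such endomorphisms that maps a given finite
  subset of \<open>\<surd>G\<close> into \<open>G\<close>. Hence every finitely generated subgroup of \<open>\<surd>G\<close> embeds in \<open>G\<close>.
\<close>

section \<open>Commutators and the lower central series\<close>

text \<open>Powers of a product are not products of powers in a nonabelian group, so power
  identities are rarely available directly. They are obtained on the abelianization, lifted to
  deeper sections of the lower central series by bilinearity of the commutator modulo the next term,
  and then corrected term by term until the series vanishes. One lifting statement,
  \<open>nilpotent_power_related\<close>, yields two facts behind the overview. Applied to roots, it
  shows that each term of the lower central series of the completion contains roots of its own
  elements; as roots are unique, the sections are torsion free. Applied to powers, it shows that the
  elements with a power in a given subgroup form a subgroup. The second fact serves twice: with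
  minimality of the completion it gives every element a power in the base group, and in the square
  of the completion it produces the graph of the extended endomorphism.\<close>

definition commutator :: "('a, 'm) monoid_scheme \<Rightarrow> 'a \<Rightarrow> 'a \<Rightarrow> 'a" where
  "commutator G x y = x \<otimes>\<^bsub>G\<^esub> y \<otimes>\<^bsub>G\<^esub> inv\<^bsub>G\<^esub> x \<otimes>\<^bsub>G\<^esub> inv\<^bsub>G\<^esub> y"

declare lower_central.simps(2) [simp del]

lemma lower_central_Suc:
  "lower_central G (Suc n) =
     generate G {commutator G x y | x y. x \<in> lower_central G n \<and> y \<in> carrier G}"
  by (simp add: commutator_def lower_central.simps)

context group
begin

lemma inv_cancel [simp]:
  assumes "x \<in> carrier G" "y \<in> carrier G"
  shows "inv x \<otimes> (x \<otimes> y) = y" "x \<otimes> (inv x \<otimes> y) = y"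
  using assms by (simp_all add: m_assoc[symmetric])

lemma commutator_closed [simp]:
  "x \<in> carrier G \<Longrightarrow> y \<in> carrier G \<Longrightarrow> commutator G x y \<in> carrier G"
  by (simp add: commutator_def)

lemma commutator_eq_one_iff:
  assumes "x \<in> carrier G" "y \<in> carrier G"
  shows "commutator G x y = \<one> \<longleftrightarrow> x \<otimes> y = y \<otimes> x"
proof -
  have "commutator G x y = (x \<otimes> y) \<otimes> inv (y \<otimes> x)"
    using assms by (simp add: commutator_def m_assoc inv_mult_group)
  then show ?thesis using assms by (metis inv_equality inv_inv m_closed inv_closed r_inv)
qed

text \<open>In general [xy, z] = x [y, z] x^-1 [x, z]; the last hypothesis removes the conjugation
  by x. The next lemma treats [x, yz] = [x, y] y [x, z] y^-1 in the same way.\<close>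

lemma commutator_mult_left:
  assumes "x \<in> carrier G" "y \<in> carrier G" "z \<in> carrier G"
    and "x \<otimes> commutator G y z = commutator G y z \<otimes> x"
  shows "commutator G (x \<otimes> y) z = commutator G y z \<otimes> commutator G x z"
proof -
  have "commutator G (x \<otimes> y) z = x \<otimes> commutator G y z \<otimes> (z \<otimes> inv x \<otimes> inv z)"
    using assms(1-3) by (simp add: commutator_def m_assoc inv_mult_group)
  also have "\<dots> = commutator G y z \<otimes> x \<otimes> (z \<otimes> inv x \<otimes> inv z)" by (simp only: assms(4))
  finally show ?thesis using assms(1-3) by (simp add: commutator_def m_assoc)
qed

lemma commutator_mult_right:
  assumes "x \<in> carrier G" "y \<in> carrier G" "z \<in> carrier G"
    and "y \<otimes> commutator G x z = commutator G x z \<otimes> y"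
  shows "commutator G x (y \<otimes> z) = commutator G x y \<otimes> commutator G x z"
proof -
  have "commutator G x (y \<otimes> z) = commutator G x y \<otimes> (y \<otimes> commutator G x z) \<otimes> inv y"
    using assms(1-3) by (simp add: commutator_def m_assoc inv_mult_group)
  also have "\<dots> = commutator G x y \<otimes> (commutator G x z \<otimes> y) \<otimes> inv y" by (simp only: assms(4))
  finally show ?thesis using assms(1-3) by (simp add: m_assoc)
qed

lemma lower_central_closed: "x \<in> lower_central G n \<Longrightarrow> x \<in> carrier G"
  by (meson lower_central_subgroup is_group subgroup.mem_carrier)

lemma lower_central_normal: "lower_central G n \<lhd> G"
proof (induction n)
  case 0
  show ?case by (simp add: normal_self)
next
  case (Suc n)
  then interpret N: normal "lower_central G n" G .
  show ?case unfolding lower_central_Suc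
  proof (rule normal_generateI)
    show "{commutator G x y | x y. x \<in> lower_central G n \<and> y \<in> carrier G} \<subseteq> carrier G"
      using lower_central_closed by auto
  next
    fix h g
    assume "h \<in> {commutator G x y | x y. x \<in> lower_central G n \<and> y \<in> carrier G}"
      and g: "g \<in> carrier G"
    then obtain x y where xy: "h = commutator G x y" "x \<in> lower_central G n" "y \<in> carrier G"
      by blast
    have "g \<otimes> h \<otimes> inv g = commutator G (g \<otimes> x \<otimes> inv g) (g \<otimes> y \<otimes> inv g)"
      using g xy by (simp add: commutator_def m_assoc inv_mult_group lower_central_closed)
    then show "g \<otimes> h \<otimes> inv g \<in> {commutator G x y | x y. x \<in> lower_central G n \<and> y \<in> carrier G}"
      using N.inv_op_closed2[OF g xy(2)] g xy(3) by blast
  qed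
qed

lemma commutator_in_lower_central:
  "x \<in> lower_central G n \<Longrightarrow> y \<in> carrier G \<Longrightarrow> commutator G x y \<in> lower_central G (Suc n)"
  unfolding lower_central_Suc by (auto intro: generate.incl)

lemma lower_central_Suc_subset: "lower_central G (Suc n) \<subseteq> lower_central G n"
  unfolding lower_central_Suc
proof (rule generate_subgroup_incl[OF subsetI lower_central_subgroup[OF is_group]])
  interpret N: normal "lower_central G n" G by (rule lower_central_normal)
  fix h assume "h \<in> {commutator G x y | x y. x \<in> lower_central G n \<and> y \<in> carrier G}"
  then obtain x y where xy: "h = commutator G x y" "x \<in> lower_central G n" "y \<in> carrier G"
    by blast
  then have "h = x \<otimes> (y \<otimes> inv x \<otimes> inv y)"
    by (simp add: commutator_def m_assoc)
  then show "h \<in> lower_central G n"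
    using xy N.inv_op_closed2[of y "inv x"] by simp
qed

lemma lower_central_antimono: "m \<le> n \<Longrightarrow> lower_central G n \<subseteq> lower_central G m"
  by (rule lift_Suc_antimono_le[of "lower_central G"]) (rule lower_central_Suc_subset)

lemma lower_central_nilpotent:
  assumes "nilpotent_of_class_le s G" "s \<le> n" shows "lower_central G n = {\<one>}"
proof -
  have "\<one> \<in> lower_central G n"
    using lower_central_subgroup[OF is_group] by (rule subgroup.one_closed)
  then show ?thesis using assms lower_central_antimono[of s n]
    by (auto simp: nilpotent_of_class_le_def)
qed

text \<open>Commutators only generate the next term, so every property established on commutators
  must be shown to define a subgroup before it reaches the whole term.\<close>

lemma lower_central_Suc_induct:
  assumes "subgroup K G"
    and "\<And>x y. x \<in> lower_central G n \<Longrightarrow> y \<in> carrier G \<Longrightarrow> commutator G x y \<in> K"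
  shows "lower_central G (Suc n) \<subseteq> K"
  unfolding lower_central_Suc using assms by (intro generate_subgroup_incl) auto

end

lemma (in group_hom) hom_commutator:
  "x \<in> carrier G \<Longrightarrow> y \<in> carrier G \<Longrightarrow> h (commutator G x y) = commutator H (h x) (h y)"
  by (simp add: commutator_def)

lemma (in group_hom) hom_lower_central: "x \<in> lower_central G n \<Longrightarrow> h x \<in> lower_central H n"
  using lower_central_hom[OF G.is_group H.is_group homh] by blast

section \<open>Central sections of the lower central series and bilinearity of the
  commutator\<close>

text \<open>The map h stands for the quotient map modulo the term of weight \<open>n + 2\<close>.
  Only its killing that term matters: elements of weight \<open>n + 1\<close> then have central
  images, so that powers of products can be computed there.\<close>

locale lower_central_quotient = group_hom G H h for G (structure) and H (structure) and h +
  fixes n :: nat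
  assumes kernel: "lower_central G (Suc n) \<subseteq> kernel G H h"
begin

lemma hom_lower_central_one: "x \<in> lower_central G (Suc n) \<Longrightarrow> h x = \<one>\<^bsub>H\<^esub>"
  using kernel by (auto simp: kernel_def)

lemma hom_lower_central_central:
  assumes "x \<in> lower_central G n" "y \<in> carrier G"
  shows "h x \<otimes>\<^bsub>H\<^esub> h y = h y \<otimes>\<^bsub>H\<^esub> h x"
  using assms hom_lower_central_one[OF G.commutator_in_lower_central[OF assms]]
  by (simp add: hom_commutator H.commutator_eq_one_iff G.lower_central_closed)

end

context lower_central_quotient
begin

text \<open>The images of elements of weight \<open>n + 1\<close> commute. Hence exponents j, j'
  with witnesses y, y' for x and x' combine to the exponent \<open>j * j'\<close> with witness
  \<open>y [^] j' \<otimes> y' [^] j\<close> for the product, which is why \<open>I\<close> has to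
  be closed under multiplication.\<close>

lemma subgroup_power_related:
  fixes I :: "nat set" and k :: nat
  assumes "1 \<in> I" "\<And>i j. i \<in> I \<Longrightarrow> j \<in> I \<Longrightarrow> i * j \<in> I" and U: "subgroup U G"
  shows "subgroup {x \<in> lower_central G n. \<exists>j\<in>I. \<exists>y \<in> U \<inter> lower_central G n.
    h x [^]\<^bsub>H\<^esub> j = h y [^]\<^bsub>H\<^esub> k} G" (is "subgroup ?K G")
proof -
  interpret U: subgroup U G by (rule U)
  interpret L: subgroup "lower_central G n" G by (rule lower_central_subgroup[OF G.is_group])
  have LU: "subgroup (U \<inter> lower_central G n) G"
    using G.subgroups_Inter_pair[OF U L.subgroup_axioms] .
  interpret LU: subgroup "U \<inter> lower_central G n" G by (rule LU)
  have pow: "y [^] i \<in> U \<inter> lower_central G n" if "y \<in> U \<inter> lower_central G n" for y and i :: nat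
    by (induction i) (use that in \<open>auto simp: LU.m_closed[simplified]\<close>)
  show ?thesis
  proof (rule G.subgroupI)
    show "?K \<subseteq> carrier G" by auto
    have "\<one> \<in> ?K" using assms(1) by (auto intro!: bexI[of _ 1] bexI[of _ "\<one>"])
    then show "?K \<noteq> {}" by blast
  next
    fix x assume "x \<in> ?K"
    then obtain j y where x: "x \<in> lower_central G n" "j \<in> I" "y \<in> U \<inter> lower_central G n"
      "h x [^]\<^bsub>H\<^esub> j = h y [^]\<^bsub>H\<^esub> k" by blast
    have c: "x \<in> carrier G" "y \<in> carrier G" using x by auto
    have "h (inv x) [^]\<^bsub>H\<^esub> j = h (inv y) [^]\<^bsub>H\<^esub> k"
      using c x(4) by (simp add: H.nat_pow_inv)
    then show "inv x \<in> ?K" using x by (blast intro: L.m_inv_closed LU.m_inv_closed)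
  next
    fix x x' assume "x \<in> ?K" "x' \<in> ?K"
    then obtain j y j' y' where x: "x \<in> lower_central G n" "j \<in> I" "y \<in> U \<inter> lower_central G n"
      "h x [^]\<^bsub>H\<^esub> j = h y [^]\<^bsub>H\<^esub> k"
      and x': "x' \<in> lower_central G n" "j' \<in> I" "y' \<in> U \<inter> lower_central G n"
      "h x' [^]\<^bsub>H\<^esub> j' = h y' [^]\<^bsub>H\<^esub> k" by blast
    have c: "x \<in> carrier G" "y \<in> carrier G" "x' \<in> carrier G" "y' \<in> carrier G" using x x' by auto
    let ?y = "y [^] j' \<otimes> y' [^] j"
    have y: "y [^] j' \<in> U \<inter> lower_central G n" "y' [^] j \<in> U \<inter> lower_central G n"
      using pow x x' by auto
    have "h (x \<otimes> x') [^]\<^bsub>H\<^esub> (j * j')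
        = h x [^]\<^bsub>H\<^esub> (j * j') \<otimes>\<^bsub>H\<^esub> h x' [^]\<^bsub>H\<^esub> (j' * j)"
      using H.pow_mult_distrib[OF hom_lower_central_central[OF x(1) c(3)], of "j * j'"] c
      by (simp add: mult.commute)
    also have "\<dots> = (h y [^]\<^bsub>H\<^esub> k) [^]\<^bsub>H\<^esub> j' \<otimes>\<^bsub>H\<^esub> (h y' [^]\<^bsub>H\<^esub> k) [^]\<^bsub>H\<^esub> j"
      using c x(4) x'(4) by (simp add: H.nat_pow_pow[symmetric])
    also have "\<dots> = h (y [^] j') [^]\<^bsub>H\<^esub> k \<otimes>\<^bsub>H\<^esub> h (y' [^] j) [^]\<^bsub>H\<^esub> k"
      using c by (simp add: hom_nat_pow H.nat_pow_pow mult.commute)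
    also have "\<dots> = h ?y [^]\<^bsub>H\<^esub> k"
    proof -
      have "h (y [^] j') \<otimes>\<^bsub>H\<^esub> h (y' [^] j) = h (y' [^] j) \<otimes>\<^bsub>H\<^esub> h (y [^] j')"
        using hom_lower_central_central y c by blast
      then have "(h (y [^] j') \<otimes>\<^bsub>H\<^esub> h (y' [^] j)) [^]\<^bsub>H\<^esub> k
          = h (y [^] j') [^]\<^bsub>H\<^esub> k \<otimes>\<^bsub>H\<^esub> h (y' [^] j) [^]\<^bsub>H\<^esub> k"
        by (rule H.pow_mult_distrib) (use c in auto)
      then show ?thesis using c by simp
    qed
    finally have "h (x \<otimes> x') [^]\<^bsub>H\<^esub> (j * j') = h ?y [^]\<^bsub>H\<^esub> k" .
    moreover have "?y \<in> U \<inter> lower_central G n" using y by (blast intro: LU.m_closed)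
    ultimately show "x \<otimes> x' \<in> ?K" using x(1,2) x'(1,2) assms(2) by (blast intro: L.m_closed)
  qed
qed

end

text \<open>Phrased with elements instead of cosets, so that a congruence can be carried along a
  homomorphism between different groups.\<close>

definition lower_central_cong :: "('a, 'm) monoid_scheme \<Rightarrow> nat \<Rightarrow> 'a \<Rightarrow> 'a \<Rightarrow> bool" where
  "lower_central_cong G n x y \<longleftrightarrow> x \<otimes>\<^bsub>G\<^esub> inv\<^bsub>G\<^esub> y \<in> lower_central G n"

lemma (in group) lower_central_congE:
  assumes "lower_central_cong G n x y" "x \<in> carrier G" "y \<in> carrier G"
  obtains u where "u \<in> lower_central G n" "x = u \<otimes> y"
  using assms that[of "x \<otimes> inv y"] by (simp add: lower_central_cong_def m_assoc)

lemma (in group_hom) lower_central_cong_hom: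
  assumes "lower_central_cong G n x y" "x \<in> carrier G" "y \<in> carrier G"
  shows "lower_central_cong H n (h x) (h y)"
  using assms hom_lower_central[of "x \<otimes> inv y"] by (simp add: lower_central_cong_def)

text \<open>Here \<open>h\<close> kills the commutators of weight \<open>n + 3\<close>, which makes \<open>h [x, y]\<close> bilinear for
  \<open>x\<close> of weight \<open>n + 1\<close> and arbitrary \<open>y\<close>.\<close>

locale commutator_quotient = group_hom G H h for G (structure) and H (structure) and h +
  fixes n :: nat
  assumes kernel_Suc: "lower_central G (Suc (Suc n)) \<subseteq> kernel G H h"
begin

sublocale lower_central_quotient G H h "Suc n"
  by unfold_locales (rule kernel_Suc)

lemma hom_commutator_central:
  assumes "x \<in> lower_central G n" "y \<in> carrier G" "z \<in> carrier G"
  shows "h z \<otimes>\<^bsub>H\<^esub> commutator H (h x) (h y) = commutator H (h x) (h y) \<otimes>\<^bsub>H\<^esub> h z"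
  using hom_lower_central_central[OF G.commutator_in_lower_central[OF assms(1,2)] assms(3)] assms
  by (simp add: hom_commutator G.lower_central_closed)

lemma hom_commutator_mult_left:
  assumes "x \<in> lower_central G n" "y \<in> lower_central G n" "z \<in> carrier G"
  shows "h (commutator G (x \<otimes> y) z) = h (commutator G x z) \<otimes>\<^bsub>H\<^esub> h (commutator G y z)"
proof -
  note c = G.lower_central_closed[OF assms(1)] G.lower_central_closed[OF assms(2)] assms(3)
  have "h (commutator G (x \<otimes> y) z) = h (commutator G y z) \<otimes>\<^bsub>H\<^esub> h (commutator G x z)"
    using c hom_commutator_central[OF assms(2,3) c(1)]
    by (simp add: hom_commutator H.commutator_mult_left)
  then show ?thesis
    using c hom_commutator_central[OF assms(1,3), of "commutator G y z"] by (simp add: hom_commutator)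
qed

lemma hom_commutator_mult_right:
  assumes "x \<in> lower_central G n" "y \<in> carrier G" "z \<in> carrier G"
  shows "h (commutator G x (y \<otimes> z)) = h (commutator G x y) \<otimes>\<^bsub>H\<^esub> h (commutator G x z)"
  using assms hom_commutator_central[OF assms(1,3,2)]
  by (simp add: hom_commutator H.commutator_mult_right G.lower_central_closed)

text \<open>As a homomorphism in the second argument, the commutator inherits its behaviour on
  powers and commutators, and its kernel is a subgroup.\<close>

lemma group_hom_commutator:
  assumes "x \<in> lower_central G n"
  shows "group_hom G H (\<lambda>y. h (commutator G x y))"
  using assms hom_commutator_mult_right[OF assms]
  by unfold_locales (auto intro!: homI simp: G.lower_central_closed)

text \<open>All values of y \<mapsto> h [x, y] are central, hence commute. A homomorphism with
  commuting values kills every commutator of its domain. This replaces an appeal to the three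
  subgroups lemma.\<close>

lemma hom_commutator_derived:
  assumes "x \<in> lower_central G n" "y \<in> lower_central G 1"
  shows "h (commutator G x y) = \<one>\<^bsub>H\<^esub>"
proof -
  interpret f: group_hom G H "\<lambda>y. h (commutator G x y)" by (rule group_hom_commutator[OF assms(1)])
  have x: "x \<in> carrier G" by (rule G.lower_central_closed[OF assms(1)])
  have "lower_central G (Suc 0) \<subseteq> kernel G H (\<lambda>y. h (commutator G x y))"
  proof (rule G.lower_central_Suc_induct[OF f.subgroup_kernel])
    fix y z assume "y \<in> lower_central G 0" "z \<in> carrier G"
    then have yz: "y \<in> carrier G" "z \<in> carrier G" by simp_all
    then have "commutator H (h (commutator G x y)) (h (commutator G x z)) = \<one>\<^bsub>H\<^esub>"
      using hom_commutator_central[OF assms(1) yz(1), of "commutator G x z"] x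
      by (simp add: H.commutator_eq_one_iff hom_commutator)
    then have "h (commutator G x (commutator G y z)) = \<one>\<^bsub>H\<^esub>" using yz f.hom_commutator by simp
    then show "commutator G y z \<in> kernel G H (\<lambda>y. h (commutator G x y))"
      using yz by (simp add: kernel_def)
  qed
  then show ?thesis using assms(2) by (auto simp: kernel_def)
qed

lemma hom_commutator_pow:
  fixes k l :: nat
  assumes x: "x \<in> lower_central G n" and y: "y \<in> carrier G"
  shows "h (commutator G (x [^] k) (y [^] l)) = h (commutator G x y) [^]\<^bsub>H\<^esub> (k * l)"
proof -
  interpret L: subgroup "lower_central G n" G by (rule lower_central_subgroup[OF G.is_group])
  interpret f: group_hom G H "\<lambda>y. h (commutator G x y)" by (rule group_hom_commutator[OF x])
  have xk: "x [^] k \<in> lower_central G n" for k :: nat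
    using x by (induction k) auto
  have "h (commutator G (x [^] k) z) = h (commutator G x z) [^]\<^bsub>H\<^esub> k" if z: "z \<in> carrier G" for z
  proof (induction k)
    case 0
    show ?case using z by (simp add: commutator_def)
  next
    case (Suc k)
    show ?case using hom_commutator_mult_left[OF xk x z] Suc by simp
  qed
  moreover have "h (commutator G x (y [^] l)) = h (commutator G x y) [^]\<^bsub>H\<^esub> l"
    using f.hom_nat_pow[OF y] .
  ultimately show ?thesis
    using x y by (simp add: H.nat_pow_pow G.lower_central_closed mult.commute)
qed

text \<open>Write x = u x' and y = v y' and expand bilinearly. The factor [u, y] has weight
  \<open>n + 3\<close> and is killed; [x', v] is killed because v lies in the derived subgroup. Thus
  knowledge of y in the abelianization suffices at every depth.\<close>

lemma hom_commutator_cong: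
  assumes "x \<in> lower_central G n" "x' \<in> lower_central G n" "lower_central_cong G (Suc n) x x'"
    and "y \<in> carrier G" "y' \<in> carrier G" "lower_central_cong G 1 y y'"
  shows "h (commutator G x y) = h (commutator G x' y')"
proof -
  obtain u where u: "u \<in> lower_central G (Suc n)" "x = u \<otimes> x'"
    using G.lower_central_congE[OF assms(3)] assms(1,2) G.lower_central_closed by metis
  obtain v where v: "v \<in> lower_central G 1" "y = v \<otimes> y'"
    using G.lower_central_congE[OF assms(6)] assms(4,5) by metis
  have u': "u \<in> lower_central G n" using u(1) G.lower_central_Suc_subset by blast
  have vc: "v \<in> carrier G" using v(1) by (rule G.lower_central_closed)
  have "h (commutator G x y) = h (commutator G u y) \<otimes>\<^bsub>H\<^esub> h (commutator G x' y)"
    using u hom_commutator_mult_left[OF u' assms(2,4)] by simp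
  also have "h (commutator G u y) = \<one>\<^bsub>H\<^esub>"
    by (rule hom_lower_central_one[OF G.commutator_in_lower_central[OF u(1) assms(4)]])
  also have "h (commutator G x' y) = h (commutator G x' v) \<otimes>\<^bsub>H\<^esub> h (commutator G x' y')"
    using v hom_commutator_mult_right[OF assms(2) vc assms(5)] by simp
  also have "h (commutator G x' v) = \<one>\<^bsub>H\<^esub>" by (rule hom_commutator_derived[OF assms(2) v(1)])
  finally show ?thesis using assms(2,5) by (simp add: G.lower_central_closed)
qed

end

section \<open>Cosets of the terms of the lower central series\<close>

context group
begin

lemma group_hom_coset: "N \<lhd> G \<Longrightarrow> group_hom G (G Mod N) ((#>) N)"
  using normal.r_coset_hom_Mod normal.factorgroup_is_group
  by (auto simp: group_hom_def group_hom_axioms_def is_group)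

lemma coset_eq_iff:
  assumes "N \<lhd> G" "x \<in> carrier G" "y \<in> carrier G"
  shows "N #> x = N #> y \<longleftrightarrow> x \<otimes> inv y \<in> N"
proof
  have N: "subgroup N G" using assms(1) by (rule normal_imp_subgroup)
  {
    assume "N #> x = N #> y"
    then have "x \<in> N #> y" using rcos_self[OF assms(2) N] by simp
    then show "x \<otimes> inv y \<in> N" by (rule subgroup.rcos_module_imp[OF N is_group assms(3)])
  next
    assume "x \<otimes> inv y \<in> N"
    then have "x \<in> N #> y" by (rule subgroup.rcos_module_rev[OF N is_group assms(3,2)])
    then show "N #> x = N #> y" using repr_independence[OF _ assms(3) N] by simp
  }
qed

lemma lower_central_coset_eq_iff:
  "x \<in> carrier G \<Longrightarrow> y \<in> carrier G \<Longrightarrow>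
    lower_central G n #> x = lower_central G n #> y \<longleftrightarrow> lower_central_cong G n x y"
  unfolding lower_central_cong_def by (rule coset_eq_iff[OF lower_central_normal])

lemma kernel_coset:
  assumes "N \<lhd> G"
  shows "kernel G (G Mod N) ((#>) N) = N"
proof -
  have N: "subgroup N G" using assms by (rule normal_imp_subgroup)
  show ?thesis
    using coset_join1[OF _ _ N] coset_join2[OF _ N] subgroup.mem_carrier[OF N]
    by (auto simp: kernel_def)
qed

lemma lower_central_quotient_coset:
  "lower_central_quotient G (G Mod lower_central G (Suc n)) ((#>) (lower_central G (Suc n))) n"
  using group_hom_coset[OF lower_central_normal] kernel_coset[OF lower_central_normal]
  by (simp add: lower_central_quotient_def lower_central_quotient_axioms_def)

lemma commutator_quotient_coset:
  "commutator_quotient G (G Mod lower_central G (Suc (Suc n)))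
     ((#>) (lower_central G (Suc (Suc n)))) n"
  using group_hom_coset[OF lower_central_normal] kernel_coset[OF lower_central_normal]
  by (simp add: commutator_quotient_def commutator_quotient_axioms_def)

end

section \<open>Lifting powers and roots from the abelianization\<close>

context group
begin

text \<open>With \<open>I = {1}\<close> the next two lemmas lift the existence of \<open>k\<close>-th roots from the abelianization,
  and with \<open>k = 1\<close> and \<open>I\<close> the positive numbers they lift the existence of powers in \<open>U\<close>.\<close>

lemma lower_central_power_related:
  fixes I :: "nat set" and k :: nat
  assumes I: "1 \<in> I" "\<And>i j. i \<in> I \<Longrightarrow> j \<in> I \<Longrightarrow> i * j \<in> I" and U: "subgroup U G"
    and base: "\<And>x. x \<in> carrier G \<Longrightarrow> \<exists>j\<in>I. \<exists>y\<in>U. lower_central_cong G 1 (x [^] j) (y [^] k)"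
    and "x \<in> lower_central G n"
  shows "\<exists>j\<in>I. \<exists>y \<in> U \<inter> lower_central G n. lower_central_cong G (Suc n) (x [^] j) (y [^] k)"
  using assms(5)
proof (induction n arbitrary: x)
  case 0
  then show ?case using base[of x] subgroup.subset[OF U] by auto
next
  case (Suc n)
  let ?N = "lower_central G (Suc (Suc n))"
  let ?K = "{x \<in> lower_central G (Suc n). \<exists>j\<in>I. \<exists>y \<in> U \<inter> lower_central G (Suc n).
    (?N #> x) [^]\<^bsub>G Mod ?N\<^esub> j = (?N #> y) [^]\<^bsub>G Mod ?N\<^esub> k}"
  interpret Q: commutator_quotient G "G Mod ?N" "(#>) ?N" n by (rule commutator_quotient_coset)
  interpret U: subgroup U G by (rule U)
  interpret L: subgroup "lower_central G n" G by (rule lower_central_subgroup[OF is_group])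
  interpret L': subgroup "lower_central G (Suc n)" G by (rule lower_central_subgroup[OF is_group])
  have UL': "y [^] i \<in> U \<inter> lower_central G (Suc n)"
    if "y \<in> U \<inter> lower_central G (Suc n)" for y and i :: nat
    using that by (induction i) auto
  have UL: "y [^] i \<in> U \<inter> lower_central G n" if "y \<in> U \<inter> lower_central G n" for y and i :: nat
    using that by (induction i) auto
  have L: "y [^] i \<in> lower_central G n" if "y \<in> lower_central G n" for y and i :: nat
    using that by (induction i) auto
  have "lower_central G (Suc n) \<subseteq> ?K"
  proof (rule lower_central_Suc_induct[OF Q.subgroup_power_related[OF I U]])
    fix x y assume x: "x \<in> lower_central G n" and y: "y \<in> carrier G"
    obtain i a where a: "i \<in> I" "a \<in> U \<inter> lower_central G n"
      "lower_central_cong G (Suc n) (x [^] i) (a [^] k)"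
      using Suc.IH[OF x] by blast
    obtain j b where b: "j \<in> I" "b \<in> U" "lower_central_cong G 1 (y [^] j) (b [^] k)"
      using base[OF y] by blast
    have c: "x \<in> carrier G" "a \<in> carrier G" "b \<in> carrier G"
      using lower_central_closed[OF x] a(2) b(2) by auto
    have ab: "commutator G a b \<in> U \<inter> lower_central G (Suc n)"
      using a(2) b(2) commutator_in_lower_central[of a n b] c by (simp add: commutator_def)
    have "?N #> commutator G (x [^] i) (y [^] j) = ?N #> commutator G (a [^] k) (b [^] k)"
      using L[OF x] UL[OF a(2), of k] a(3) b(3) c y by (intro Q.hom_commutator_cong) auto
    then have "(?N #> commutator G x y) [^]\<^bsub>G Mod ?N\<^esub> (i * j)
        = (?N #> commutator G a b) [^]\<^bsub>G Mod ?N\<^esub> (k * k)"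
      using Q.hom_commutator_pow[OF x y] Q.hom_commutator_pow[of a b] a(2) c by simp
    \<comment> \<open>Bilinearity yields the exponent \<open>k * k\<close>, but only one k is wanted
      outside; the other goes into the witness \<open>commutator G a b [^] k\<close>, which stays in
      \<open>U\<close>.\<close>
    also have "\<dots> = (?N #> (commutator G a b [^] k)) [^]\<^bsub>G Mod ?N\<^esub> k"
      using c by (simp add: Q.hom_nat_pow Q.H.nat_pow_pow)
    finally show "commutator G x y \<in> ?K"
      using UL'[OF ab, of k] commutator_in_lower_central[OF x y] I(2)[OF a(1) b(1)] by blast
  qed
  then obtain j y where jy: "j \<in> I" "y \<in> U \<inter> lower_central G (Suc n)"
    "(?N #> x) [^]\<^bsub>G Mod ?N\<^esub> j = (?N #> y) [^]\<^bsub>G Mod ?N\<^esub> k"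
    using Suc.prems by blast
  have c: "x \<in> carrier G" "y \<in> carrier G" using Suc.prems jy(2) by auto
  have "?N #> (x [^] j) = ?N #> (y [^] k)" using jy(3) c by (simp add: Q.hom_nat_pow)
  then have "lower_central_cong G (Suc (Suc n)) (x [^] j) (y [^] k)"
    using c by (simp add: lower_central_coset_eq_iff)
  then show ?case using jy by blast
qed

lemma nilpotent_power_related:
  fixes I :: "nat set" and k :: nat
  assumes "nilpotent G" and I: "1 \<in> I" "\<And>i j. i \<in> I \<Longrightarrow> j \<in> I \<Longrightarrow> i * j \<in> I" and U: "subgroup U G"
    and base: "\<And>x. x \<in> carrier G \<Longrightarrow> \<exists>j\<in>I. \<exists>y\<in>U. lower_central_cong G 1 (x [^] j) (y [^] k)"
    and x: "x \<in> lower_central G n"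
  shows "\<exists>j\<in>I. \<exists>y \<in> U \<inter> lower_central G n. x [^] j = y [^] k"
proof -
  interpret U: subgroup U G by (rule U)
  interpret L: subgroup "lower_central G n" G by (rule lower_central_subgroup[OF is_group])
  have UL: "y [^] i \<in> U \<inter> lower_central G n" if "y \<in> U \<inter> lower_central G n" for y and i :: nat
    using that by (induction i) auto
  have xc: "x \<in> carrier G" using x by (rule lower_central_closed)
  \<comment> \<open>Successive approximation: the relation is improved modulo ever deeper terms, at
    the price of a larger exponent in each round.\<close>
  have approx: "\<exists>j\<in>I. \<exists>y \<in> U \<inter> lower_central G n. lower_central_cong G m (x [^] j) (y [^] k)"
    if "m \<ge> Suc n" for m
    using that
  proof (induction m rule: dec_induct)
    case base
    show ?case by (rule lower_central_power_related[OF I U assms(5) x])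
  next
    case (step m)
    obtain j y where jy: "j \<in> I" "y \<in> U \<inter> lower_central G n"
      "lower_central_cong G m (x [^] j) (y [^] k)" using step.IH by blast
    have yc: "y \<in> carrier G" using jy(2) by auto
    obtain u where u: "u \<in> lower_central G m" "x [^] j = u \<otimes> y [^] k"
      using lower_central_congE[OF jy(3)] xc yc by auto
    obtain i v where v: "i \<in> I" "v \<in> U \<inter> lower_central G m"
      "lower_central_cong G (Suc m) (u [^] i) (v [^] k)"
      using lower_central_power_related[OF I U assms(5) u(1)] by blast
    have uc: "u \<in> carrier G" and vc: "v \<in> carrier G"
      using u(1) v(2) lower_central_closed by auto
    let ?N = "lower_central G (Suc m)"
    interpret Q: lower_central_quotient G "G Mod ?N" "(#>) ?N" m by (rule lower_central_quotient_coset)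
    have central: "(?N #> z) \<otimes>\<^bsub>G Mod ?N\<^esub> (?N #> w) = (?N #> w) \<otimes>\<^bsub>G Mod ?N\<^esub> (?N #> z)"
      if "z \<in> lower_central G m" "w \<in> carrier G" for z w
      using Q.hom_lower_central_central that by blast
    \<comment> \<open>The error u is central modulo the next term, so
      \<open>(u \<otimes> y [^] k) [^] i\<close> becomes
      \<open>u [^] i \<otimes> y [^] (k * i)\<close>. Replacing \<open>u [^] i\<close> by
      \<open>v [^] k\<close> turns this into the k-th power of
      \<open>v \<otimes> y [^] i\<close>.\<close>
    have "x [^] (j * i) = (u \<otimes> y [^] k) [^] i" using xc u(2) by (simp add: nat_pow_pow[symmetric])
    then have "?N #> (x [^] (j * i))
        = ((?N #> u) \<otimes>\<^bsub>G Mod ?N\<^esub> (?N #> y [^] k)) [^]\<^bsub>G Mod ?N\<^esub> i"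
      using uc yc by (simp only: Q.hom_nat_pow Q.hom_mult m_closed nat_pow_closed)
    also have "\<dots> = (?N #> (u [^] i)) \<otimes>\<^bsub>G Mod ?N\<^esub> ((?N #> y) [^]\<^bsub>G Mod ?N\<^esub> (i * k))"
      using Q.H.pow_mult_distrib[OF central[OF u(1), of "y [^] k"], of i] uc yc
      by (simp add: Q.hom_nat_pow Q.H.nat_pow_pow mult.commute)
    also have "?N #> (u [^] i) = ?N #> (v [^] k)"
      using v(3) uc vc by (simp add: lower_central_coset_eq_iff)
    also have "(?N #> (v [^] k)) \<otimes>\<^bsub>G Mod ?N\<^esub> ((?N #> y) [^]\<^bsub>G Mod ?N\<^esub> (i * k))
        = ?N #> ((v \<otimes> y [^] i) [^] k)"
      using Q.H.pow_mult_distrib[OF central[of v "y [^] i"], of k] v(2) vc yc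
      by (simp add: Q.hom_nat_pow Q.H.nat_pow_pow)
    finally have "lower_central_cong G (Suc m) (x [^] (j * i)) ((v \<otimes> y [^] i) [^] k)"
      using xc vc yc by (simp add: lower_central_coset_eq_iff)
    moreover have "v \<otimes> y [^] i \<in> U \<inter> lower_central G n"
      using UL[OF jy(2), of i] v(2) lower_central_antimono[of n m] step.hyps(1) by auto
    ultimately show ?case using I(2)[OF jy(1) v(1)] by blast
  qed
  obtain s where s: "nilpotent_of_class_le s G" using assms(1) by (auto simp: nilpotent_def)
  \<comment> \<open>The approximation starts at \<open>Suc n\<close>, and from s on the terms are
    trivial; at the maximum of both, congruence is equality.\<close>
  obtain j y where jy: "j \<in> I" "y \<in> U \<inter> lower_central G n"
    "lower_central_cong G (max s (Suc n)) (x [^] j) (y [^] k)"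
    using approx[of "max s (Suc n)"] by auto
  then have "x [^] j = y [^] k"
    using xc lower_central_congE[OF jy(3)] lower_central_nilpotent[OF s, of "max s (Suc n)"] by auto
  then show ?thesis using jy by blast
qed

text \<open>The case \<open>I = {1}\<close> with the whole group as \<open>U\<close>. A root in the
  group gives a root in the abelianization, and lifting then finds one of the same weight as
  x.\<close>

lemma roots_in_lower_central:
  assumes "nilpotent G" "\<And>x. x \<in> carrier G \<Longrightarrow> \<exists>y\<in>carrier G. y [^] (k::nat) = x"
    and "x \<in> lower_central G n"
  shows "\<exists>y\<in>lower_central G n. y [^] k = x"
proof -
  have one: "\<one> \<in> lower_central G 1"
    by (rule subgroup.one_closed[OF lower_central_subgroup[OF is_group]])
  have "\<exists>j\<in>{1::nat}. \<exists>y\<in>carrier G. lower_central_cong G 1 (x [^] j) (y [^] k)"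
    if x: "x \<in> carrier G" for x
  proof -
    obtain y where "y \<in> carrier G" "y [^] k = x" using assms(2)[OF x] by blast
    then show ?thesis using x one by (auto simp: lower_central_cong_def intro!: bexI[of _ y])
  qed
  from nilpotent_power_related[OF assms(1) _ _ subgroup_self this assms(3)]
  show ?thesis using lower_central_closed[OF assms(3)] by auto
qed

text \<open>Modulo the derived subgroup everything commutes, so the elements with a power in the
  image of \<open>U\<close> form a subgroup containing the generators; the lifting does the rest.
  Nilpotency is essential: the infinite dihedral group is generated by two involutions, yet their
  product has no nontrivial power equal to the unit.\<close>

lemma generate_power_in_subgroup:
  assumes "nilpotent G" "subgroup U G" "S \<subseteq> carrier G" "generate G S = carrier G"
    and "\<And>x. x \<in> S \<Longrightarrow> \<exists>k::nat. k \<ge> 1 \<and> x [^] k \<in> U" and "x \<in> carrier G"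
  shows "\<exists>k::nat. k \<ge> 1 \<and> x [^] k \<in> U"
proof -
  let ?I = "{1::nat..}"
  have I: "1 \<in> ?I" "\<And>i j. i \<in> ?I \<Longrightarrow> j \<in> ?I \<Longrightarrow> i * j \<in> ?I" by auto
  let ?N = "lower_central G (Suc 0)"
  let ?K = "{x \<in> lower_central G 0. \<exists>j\<in>?I. \<exists>y \<in> U \<inter> lower_central G 0.
    (?N #> x) [^]\<^bsub>G Mod ?N\<^esub> j = (?N #> y) [^]\<^bsub>G Mod ?N\<^esub> (1::nat)}"
  interpret Q: lower_central_quotient G "G Mod ?N" "(#>) ?N" 0 by (rule lower_central_quotient_coset)
  have Uc: "y \<in> carrier G" if "y \<in> U" for y using subgroup.mem_carrier[OF assms(2) that] .
  have "generate G S \<subseteq> ?K"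
  proof (rule generate_subgroup_incl[OF subsetI Q.subgroup_power_related[OF I assms(2)]])
    fix x assume x: "x \<in> S"
    then obtain k :: nat where k: "k \<ge> 1" "x [^] k \<in> U" using assms(5) by blast
    have "x \<in> carrier G" using x assms(3) by blast
    then have "(?N #> x) [^]\<^bsub>G Mod ?N\<^esub> k = (?N #> (x [^] k)) [^]\<^bsub>G Mod ?N\<^esub> (1::nat)"
      by (simp only: Q.hom_nat_pow[symmetric] nat_pow_closed) simp
    then show "x \<in> ?K" using k \<open>x \<in> carrier G\<close> by auto
  qed
  have "\<exists>j\<in>?I. \<exists>y\<in>U. lower_central_cong G 1 (x [^] j) (y [^] (1::nat))" if x: "x \<in> carrier G" for x
  proof -
    have "x \<in> ?K" using x assms(4) \<open>generate G S \<subseteq> ?K\<close> by blast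
    then obtain j y where jy: "j \<in> ?I" "y \<in> U"
      "(?N #> x) [^]\<^bsub>G Mod ?N\<^esub> j = (?N #> y) [^]\<^bsub>G Mod ?N\<^esub> (1::nat)" by blast
    then have "?N #> (x [^] j) = ?N #> (y [^] (1::nat))"
      using x Uc[OF jy(2)] by (simp only: Q.hom_nat_pow)
    then have "lower_central_cong G (Suc 0) (x [^] j) (y [^] (1::nat))"
      using x Uc[OF jy(2)] lower_central_coset_eq_iff nat_pow_closed by blast
    then show ?thesis using jy(1,2) One_nat_def by metis
  qed
  from nilpotent_power_related[OF assms(1) I assms(2) this, of x 0]
  show ?thesis using assms(6) Uc by auto
qed

end

section \<open>Isolators\<close>

definition isolator :: "('a, 'm) monoid_scheme \<Rightarrow> 'a set \<Rightarrow> 'a set" where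
  "isolator G U = {x \<in> carrier G. \<exists>k::nat. k \<ge> 1 \<and> x [^]\<^bsub>G\<^esub> k \<in> U}"

lemma nilpotent_hom_kernel:
  assumes "group G" "nilpotent_of_class_le s H" "h \<in> hom G H" "x \<in> lower_central G s"
  shows "h x = \<one>\<^bsub>H\<^esub>"
  using lower_central_hom[OF assms(1) _ assms(3), of s] assms(2,4)
  by (auto simp: nilpotent_of_class_le_def)

context group
begin

lemma nilpotent_subgroup:
  assumes "nilpotent G" "subgroup U G"
  shows "nilpotent (G\<lparr>carrier := U\<rparr>)"
proof -
  have U: "group (G\<lparr>carrier := U\<rparr>)" by (rule subgroup_imp_group[OF assms(2)])
  obtain s where s: "nilpotent_of_class_le s G" using assms(1) by (auto simp: nilpotent_def)
  have i: "id \<in> hom (G\<lparr>carrier := U\<rparr>) G"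
    using subgroup.mem_carrier[OF assms(2)] by (auto intro: homI)
  have "lower_central (G\<lparr>carrier := U\<rparr>) s \<subseteq> {\<one>}"
    using nilpotent_hom_kernel[OF U s i] by auto
  moreover have "\<one> \<in> lower_central (G\<lparr>carrier := U\<rparr>) s"
    using subgroup.one_closed[OF lower_central_subgroup[OF U], of s] by simp
  ultimately show ?thesis using U by (auto simp: nilpotent_def nilpotent_of_class_le_def)
qed

text \<open>The isolator generates a subgroup, and inside it every generator has a power in
  \<open>U\<close>. By the preceding result all its elements do, so the generated subgroup is no
  larger than the isolator.\<close>

lemma subgroup_isolator:
  assumes "nilpotent G" and U: "subgroup U G"
  shows "subgroup (isolator G U) G"
proof -
  let ?S = "isolator G U"
  let ?K = "generate G ?S"
  let ?G = "G\<lparr>carrier := ?K\<rparr>"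
  have S: "?S \<subseteq> carrier G" by (auto simp: isolator_def)
  have K: "subgroup ?K G" by (rule generate_is_subgroup[OF S])
  have SK: "?S \<subseteq> ?K" by (auto intro: generate.incl)
  have US: "U \<subseteq> ?S"
    using subgroup.mem_carrier[OF U] by (auto simp: isolator_def intro!: exI[of _ 1])
  interpret K: group ?G by (rule subgroup_imp_group[OF K])
  have UK: "subgroup U ?G" by (rule subgroup_incl[OF U K]) (use US SK in blast)
  have pow: "x [^]\<^bsub>?G\<^esub> k = x [^] k" for x and k :: nat by (simp add: nat_pow_def)
  have gen: "generate ?G ?S = carrier ?G" using generate_consistent[OF SK K] by simp
  have "?K \<subseteq> ?S"
  proof
    fix x assume x: "x \<in> ?K"
    have "\<exists>k::nat. k \<ge> 1 \<and> x [^]\<^bsub>?G\<^esub> k \<in> U"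
    proof (rule K.generate_power_in_subgroup[OF nilpotent_subgroup[OF assms(1) K] UK _ gen])
      show "\<exists>k::nat. k \<ge> 1 \<and> z [^]\<^bsub>?G\<^esub> k \<in> U" if "z \<in> ?S" for z
        using that unfolding pow by (simp add: isolator_def)
    qed (use SK x in simp_all)
    then show "x \<in> ?S" using subgroup.mem_carrier[OF K x] unfolding pow by (auto simp: isolator_def)
  qed
  then have "?K = ?S" using SK by blast
  then show ?thesis using K by simp
qed

end

lemma nat_pow_DirProd:
  "(a, b) [^]\<^bsub>G \<times>\<times> H\<^esub> (k::nat) = (a [^]\<^bsub>G\<^esub> k, b [^]\<^bsub>H\<^esub> k)"
  by (induction k) simp_all

text \<open>Both projections send a sufficiently deep term to the unit. This allows isolators to be
  taken inside the square of a nilpotent group.\<close>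

lemma nilpotent_DirProd:
  assumes "nilpotent G" "nilpotent H"
  shows "nilpotent (G \<times>\<times> H)"
proof -
  obtain s t where s: "nilpotent_of_class_le s G" and t: "nilpotent_of_class_le t H"
    using assms by (auto simp: nilpotent_def)
  then have G: "group G" and H: "group H" by (simp_all add: nilpotent_of_class_le_def)
  then have GH: "group (G \<times>\<times> H)" by (rule DirProd_group)
  have s': "nilpotent_of_class_le (max s t) G"
    using group.lower_central_nilpotent[OF G s, of "max s t"] G by (simp add: nilpotent_of_class_le_def)
  have t': "nilpotent_of_class_le (max s t) H"
    using group.lower_central_nilpotent[OF H t, of "max s t"] H by (simp add: nilpotent_of_class_le_def)
  have fst: "fst \<in> hom (G \<times>\<times> H) G" and snd: "snd \<in> hom (G \<times>\<times> H) H"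
    by (auto intro!: homI simp: mult_DirProd')
  have "x = \<one>\<^bsub>G \<times>\<times> H\<^esub>" if "x \<in> lower_central (G \<times>\<times> H) (max s t)" for x
    using nilpotent_hom_kernel[OF GH s' fst that] nilpotent_hom_kernel[OF GH t' snd that]
    by (simp add: prod_eq_iff)
  moreover have "\<one>\<^bsub>G \<times>\<times> H\<^esub> \<in> lower_central (G \<times>\<times> H) (max s t)"
    using lower_central_subgroup[OF GH] by (rule subgroup.one_closed)
  ultimately have "lower_central (G \<times>\<times> H) (max s t) = {\<one>\<^bsub>G \<times>\<times> H\<^esub>}" by blast
  then show ?thesis using GH unfolding nilpotent_def nilpotent_of_class_le_def by blast
qed

section \<open>Groups with unique roots\<close>

locale nilpotent_with_roots = group R for R :: "'b monoid" (structure) +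
  assumes roots: "torsion_free_nilpotent_with_roots R"
begin

lemma nilpotent: "nilpotent R"
  using roots by (simp add: torsion_free_nilpotent_with_roots_def)

lemma root_exists: "x \<in> carrier R \<Longrightarrow> k \<ge> 1 \<Longrightarrow> \<exists>y\<in>carrier R. y [^] (k::nat) = x"
  using roots unfolding torsion_free_nilpotent_with_roots_def by blast

lemma root_unique:
  assumes "x [^] (k::nat) = y [^] k" "x \<in> carrier R" "y \<in> carrier R" "k \<ge> 1"
  shows "x = y"
proof -
  have "\<exists>!z. z \<in> carrier R \<and> z [^] k = y [^] k"
    using roots assms(3,4) unfolding torsion_free_nilpotent_with_roots_def by simp
  then show ?thesis using assms(1-3) by blast
qed

text \<open>This is the torsion freeness of the sections: the power of x has a root inside the term,
  and uniqueness of roots identifies it with x.\<close>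

lemma lower_central_isolated:
  assumes "x [^] (k::nat) \<in> lower_central R n" "x \<in> carrier R" "k \<ge> 1"
  shows "x \<in> lower_central R n"
proof -
  obtain y where y: "y \<in> lower_central R n" "y [^] k = x [^] k"
    using roots_in_lower_central[OF nilpotent root_exists assms(1)] assms(3) by blast
  then show ?thesis using root_unique[OF y(2) lower_central_closed[OF y(1)] assms(2,3)] by simp
qed

text \<open>The graph of the extension is the isolator in \<open>R \<times> R\<close> of the image of \<open>g \<mapsto> (\<iota> g, \<theta> g)\<close>.\<close>

lemma extend_hom:
  assumes "group G" and \<iota>: "\<iota> \<in> hom G R" "inj_on \<iota> (carrier G)" and \<theta>: "\<theta> \<in> hom G R"
    and dense: "isolator R (\<iota> ` carrier G) = carrier R"
  shows "\<exists>\<Phi>\<in>hom R R. \<forall>g\<in>carrier G. \<Phi> (\<iota> g) = \<theta> g"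
proof -
  interpret G: group G by fact
  interpret \<iota>: group_hom G R \<iota> using \<iota>(1) by unfold_locales
  interpret \<theta>: group_hom G R \<theta> using \<theta> by unfold_locales
  let ?P = "R \<times>\<times> R" and ?\<Gamma> = "(\<lambda>g. (\<iota> g, \<theta> g)) ` carrier G"
  interpret P: group ?P by (rule DirProd_group[OF is_group is_group])
  interpret \<gamma>: group_hom G ?P "\<lambda>g. (\<iota> g, \<theta> g)" by unfold_locales (auto intro: homI)
  let ?I = "isolator ?P ?\<Gamma>"
  interpret I: subgroup ?I ?P
    by (rule P.subgroup_isolator[OF nilpotent_DirProd[OF nilpotent nilpotent] \<gamma>.img_is_subgroup])
  \<comment> \<open>If a power of a equals \<open>\<iota> g\<close>, the value at a must be the root
    of \<open>\<theta> g\<close> of the same order.\<close>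
  have total: "\<exists>b\<in>carrier R. (a, b) \<in> ?I" if a: "a \<in> carrier R" for a
  proof -
    obtain k g where k: "(k::nat) \<ge> 1" "g \<in> carrier G" "a [^] k = \<iota> g"
      using a dense unfolding isolator_def by blast
    obtain b where b: "b \<in> carrier R" "b [^] k = \<theta> g"
      using root_exists[OF \<theta>.hom_closed[OF k(2)] k(1)] by blast
    then show ?thesis using a k by (auto simp: isolator_def nat_pow_DirProd)
  qed
  have unique: "b = c" if I: "(a, b) \<in> ?I" "(a, c) \<in> ?I" for a b c
  proof -
    have abc: "a \<in> carrier R" "b \<in> carrier R" "c \<in> carrier R" using I I.subset by auto
    \<comment> \<open>Two values over the same a give a point of the isolator over the unit.
      Injectivity of \<iota> makes a power of its second coordinate trivial, hence that coordinate
      itself.\<close>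
    have "(a, b) \<otimes>\<^bsub>?P\<^esub> inv\<^bsub>?P\<^esub> (a, c) \<in> ?I" using I by blast
    then have "(\<one>, b \<otimes> inv c) \<in> ?I" using abc is_group by simp
    then obtain k g where k: "(k::nat) \<ge> 1" "g \<in> carrier G" "\<iota> g = \<one>" "(b \<otimes> inv c) [^] k = \<theta> g"
      by (auto simp: isolator_def nat_pow_DirProd)
    then have "g = \<one>\<^bsub>G\<^esub>" using \<iota>.inj_on_one_iff \<iota>(2) by blast
    then have "(b \<otimes> inv c) [^] k = \<one> [^] k" using k(4) by simp
    then have "b \<otimes> inv c = \<one>" using root_unique[OF _ _ _ k(1)] abc by blast
    then show ?thesis using abc by (metis inv_equality inv_inv inv_closed)
  qed
  obtain \<Phi> where \<Phi>: "\<And>a. a \<in> carrier R \<Longrightarrow> \<Phi> a \<in> carrier R \<and> (a, \<Phi> a) \<in> ?I"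
    using total by metis
  have "\<Phi> \<in> hom R R"
  proof (rule homI)
    fix a b assume ab: "a \<in> carrier R" "b \<in> carrier R"
    then have "(a, \<Phi> a) \<otimes>\<^bsub>?P\<^esub> (b, \<Phi> b) \<in> ?I" using \<Phi> by (intro I.m_closed) auto
    then have "(a \<otimes> b, \<Phi> a \<otimes> \<Phi> b) \<in> ?I" by simp
    then show "\<Phi> (a \<otimes> b) = \<Phi> a \<otimes> \<Phi> b" using \<Phi>[OF m_closed[OF ab]] unique by blast
  qed (use \<Phi> in blast)
  moreover have "\<Phi> (\<iota> g) = \<theta> g" if g: "g \<in> carrier G" for g
  proof (rule unique)
    show "(\<iota> g, \<theta> g) \<in> ?I" using g by (auto simp: isolator_def intro!: exI[of _ 1])
  qed (use g \<Phi> in auto)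
  ultimately show ?thesis by blast
qed

end

lemma nilpotent_with_rootsI:
  "torsion_free_nilpotent_with_roots R \<Longrightarrow> nilpotent_with_roots R"
  by (simp add: nilpotent_with_roots_def nilpotent_with_roots_axioms_def
      torsion_free_nilpotent_with_roots_def)

text \<open>The isolator is a subgroup containing the image, and it is closed under roots because a
  power of a power is a power. Minimality of the completion leaves no room outside it.\<close>

lemma maltsev_completion_dense:
  assumes "group G" and M: "maltsev_completion G R \<iota>"
  shows "isolator R (\<iota> ` carrier G) = carrier R"
proof -
  have R: "torsion_free_nilpotent_with_roots R" and \<iota>: "\<iota> \<in> hom G R"
    using M by (simp_all add: maltsev_completion_def mon_def)
  interpret nilpotent_with_roots R by (rule nilpotent_with_rootsI[OF R])
  interpret \<iota>: group_hom G R \<iota>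
    using \<iota> assms(1) is_group by (simp add: group_hom_def group_hom_axioms_def)
  let ?S = "isolator R (\<iota> ` carrier G)"
  let ?R = "R\<lparr>carrier := ?S\<rparr>"
  have S: "subgroup ?S R" by (rule subgroup_isolator[OF nilpotent \<iota>.img_is_subgroup])
  have pow: "x [^]\<^bsub>?R\<^esub> k = x [^]\<^bsub>R\<^esub> k" for x and k :: nat by (simp add: nat_pow_def)
  have root_mem: "y \<in> ?S" if y: "y \<in> carrier R" "y [^]\<^bsub>R\<^esub> k \<in> ?S" "k \<ge> 1" for y and k :: nat
  proof -
    obtain j :: nat where j: "j \<ge> 1" "(y [^]\<^bsub>R\<^esub> k) [^]\<^bsub>R\<^esub> j \<in> \<iota> ` carrier G"
      using y(2) by (auto simp: isolator_def)
    then have "y [^]\<^bsub>R\<^esub> (k * j) \<in> \<iota> ` carrier G" using y(1) by (simp add: nat_pow_pow)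
    moreover have "k * j \<ge> 1" using j(1) y(3) by simp
    ultimately show ?thesis using y(1) unfolding isolator_def by blast
  qed
  have "torsion_free_nilpotent_with_roots ?R"
    unfolding torsion_free_nilpotent_with_roots_def
  proof (intro conjI ballI allI impI)
    show "group ?R" by (rule subgroup_imp_group[OF S])
    show "nilpotent ?R" by (rule nilpotent_subgroup[OF nilpotent S])
    show "torsion_free ?R"
      using R subgroup.mem_carrier[OF S] unfolding torsion_free_nilpotent_with_roots_def
        torsion_free_def pow by auto
  next
    fix x :: 'b and k :: nat assume "x \<in> carrier ?R" and k: "k \<ge> 1"
    then have x: "x \<in> ?S" by simp
    obtain y where y: "y \<in> carrier R" "y [^]\<^bsub>R\<^esub> k = x"
      using root_exists[OF subgroup.mem_carrier[OF S x] k] by blast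
    show "\<exists>!y. y \<in> carrier ?R \<and> y [^]\<^bsub>?R\<^esub> k = x"
      unfolding pow
    proof (rule ex1I[of _ y])
      show "y \<in> carrier ?R \<and> y [^]\<^bsub>R\<^esub> k = x" using root_mem[OF y(1) _ k] y(2) x by simp
    next
      fix z assume z: "z \<in> carrier ?R \<and> z [^]\<^bsub>R\<^esub> k = x"
      then have "z \<in> carrier R" using subgroup.mem_carrier[OF S] by simp
      then show "z = y" using root_unique[of z k y] z y k by simp
    qed
  qed
  moreover have "\<iota> ` carrier G \<subseteq> ?S" by (auto simp: isolator_def intro!: exI[of _ 1])
  ultimately show ?thesis using M S unfolding maltsev_completion_def by blast
qed

section \<open>Power endomorphisms\<close>

text \<open>The exponent is \<open>m ^ Suc n\<close> because index n means weight
  \<open>n + 1\<close>. In the step, one argument of the commutator contributes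
  \<open>m ^ Suc n\<close> and the other m.\<close>

lemma (in group) power_endomorphism_lower_central:
  assumes \<phi>: "\<phi> \<in> hom G G"
    and power: "\<And>x. x \<in> carrier G \<Longrightarrow> lower_central_cong G 1 (\<phi> x) (x [^] (m::nat))"
    and "x \<in> lower_central G n"
  shows "lower_central_cong G (Suc n) (\<phi> x) (x [^] (m ^ Suc n))"
  using assms(3)
proof (induction n arbitrary: x)
  case 0
  then show ?case using power by simp
next
  case (Suc n)
  interpret \<phi>: group_hom G G \<phi> using \<phi> by unfold_locales
  let ?N = "lower_central G (Suc (Suc n))" and ?M = "m ^ Suc (Suc n)"
  interpret Q: commutator_quotient G "G Mod ?N" "(#>) ?N" n by (rule commutator_quotient_coset)
  interpret L: subgroup "lower_central G n" G by (rule lower_central_subgroup[OF is_group])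
  interpret L': subgroup "lower_central G (Suc n)" G by (rule lower_central_subgroup[OF is_group])
  let ?K = "{x \<in> lower_central G (Suc n). ?N #> \<phi> x = (?N #> x) [^]\<^bsub>G Mod ?N\<^esub> ?M}"
  have L: "y [^] i \<in> lower_central G n" if "y \<in> lower_central G n" for y and i :: nat
    using that by (induction i) auto
  \<comment> \<open>On the central image of the term, raising to the power \<open>?M\<close> is a
    homomorphism, so \<open>?K\<close> is the set where two homomorphisms agree.\<close>
  have "subgroup ?K G"
  proof (rule subgroupI)
    show "?K \<subseteq> carrier G" by auto
    have "\<one> \<in> ?K" using L'.one_closed by (simp add: Q.hom_one del: one_FactGroup)
    then show "?K \<noteq> {}" by blast
  next
    fix x assume "x \<in> ?K"
    then have x: "x \<in> lower_central G (Suc n)" "x \<in> carrier G"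
      "?N #> \<phi> x = (?N #> x) [^]\<^bsub>G Mod ?N\<^esub> ?M" by auto
    have "?N #> \<phi> (inv x) = (?N #> inv x) [^]\<^bsub>G Mod ?N\<^esub> ?M"
      using x(2,3) by (simp only: \<phi>.hom_inv Q.hom_inv \<phi>.hom_closed Q.hom_closed Q.H.nat_pow_inv)
    then show "inv x \<in> ?K" using x(1) by blast
  next
    fix x y assume "x \<in> ?K" "y \<in> ?K"
    then have xy: "x \<in> lower_central G (Suc n)" "y \<in> lower_central G (Suc n)"
      "x \<in> carrier G" "y \<in> carrier G"
      "?N #> \<phi> x = (?N #> x) [^]\<^bsub>G Mod ?N\<^esub> ?M" "?N #> \<phi> y = (?N #> y) [^]\<^bsub>G Mod ?N\<^esub> ?M" by auto
    have "?N #> \<phi> (x \<otimes> y) = (?N #> (x \<otimes> y)) [^]\<^bsub>G Mod ?N\<^esub> ?M"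
      using xy(3-6) Q.H.pow_mult_distrib[OF Q.hom_lower_central_central[OF xy(1,4)], of ?M]
      by (simp only: \<phi>.hom_mult Q.hom_mult \<phi>.hom_closed Q.hom_closed)
    then show "x \<otimes> y \<in> ?K" using xy(1,2) by blast
  qed
  then have "lower_central G (Suc n) \<subseteq> ?K"
  proof (rule lower_central_Suc_induct)
    fix x y assume x: "x \<in> lower_central G n" and y: "y \<in> carrier G"
    have xc: "x \<in> carrier G" using x by (rule lower_central_closed)
    have "?N #> \<phi> (commutator G x y) = ?N #> commutator G (\<phi> x) (\<phi> y)"
      using xc y by (simp add: \<phi>.hom_commutator)
    also have "\<dots> = ?N #> commutator G (x [^] (m ^ Suc n)) (y [^] m)"
      using Suc.IH[OF x] power[OF y] x y L[OF x] \<phi>.hom_lower_central[OF x]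
      by (intro Q.hom_commutator_cong) auto
    also have "\<dots> = (?N #> commutator G x y) [^]\<^bsub>G Mod ?N\<^esub> (m ^ Suc n * m)"
      by (rule Q.hom_commutator_pow[OF x y])
    finally show "commutator G x y \<in> ?K"
      using commutator_in_lower_central[OF x y] by (simp add: mult.commute)
  qed
  then have "?N #> \<phi> x = ?N #> (x [^] ?M)"
    using Suc.prems lower_central_closed[OF Suc.prems] by (auto simp: Q.hom_nat_pow)
  then show ?case
    using lower_central_closed[OF Suc.prems] by (simp add: lower_central_coset_eq_iff)
qed

context nilpotent_with_roots
begin

text \<open>An element of the kernel sinks through the whole series: if it has weight
  \<open>n + 1\<close>, its power with exponent \<open>m ^ Suc n\<close> has weight
  \<open>n + 2\<close>, and then so has the element itself because the terms are isolated.\<close>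

lemma power_endomorphism_inj:
  assumes \<Phi>: "\<Phi> \<in> hom R R"
    and power: "\<And>x. x \<in> carrier R \<Longrightarrow> lower_central_cong R 1 (\<Phi> x) (x [^] (m::nat))" and "m \<ge> 1"
  shows "inj_on \<Phi> (carrier R)"
proof -
  interpret \<Phi>: group_hom R R \<Phi> using \<Phi> by unfold_locales
  have "x = \<one>" if x: "x \<in> carrier R" "\<Phi> x = \<one>" for x
  proof -
    have mem: "x \<in> lower_central R n" for n
    proof (induction n)
      case (Suc n)
      have "lower_central_cong R (Suc n) \<one> (x [^] (m ^ Suc n))"
        using power_endomorphism_lower_central[OF \<Phi> power Suc] x by simp
      then have "inv (x [^] (m ^ Suc n)) \<in> lower_central R (Suc n)"
        using x(1) by (simp add: lower_central_cong_def)
      from subgroup.m_inv_closed[OF lower_central_subgroup[OF is_group] this] show ?case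
        using lower_central_isolated[of x "m ^ Suc n" "Suc n"] x(1) assms(3) by simp
    qed (simp add: x)
    obtain s where "nilpotent_of_class_le s R" using nilpotent by (auto simp: nilpotent_def)
    then show ?thesis using mem[of s] by (simp add: nilpotent_of_class_le_def)
  qed
  then show ?thesis by (simp add: \<Phi>.inj_on_one_iff)
qed

text \<open>The defect \<Phi> x (x^m)^-1 has a power in the derived subgroup, since some power of x
  lies in \<open>A\<close> and the abelianization is commutative. The derived subgroup is isolated,
  so the defect lies in it.\<close>

lemma power_endomorphism_extend:
  assumes \<Phi>: "\<Phi> \<in> hom R R" and dense: "isolator R A = carrier R"
    and power: "\<And>x. x \<in> A \<Longrightarrow> lower_central_cong R 1 (\<Phi> x) (x [^] (m::nat))"
    and x: "x \<in> carrier R"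
  shows "lower_central_cong R 1 (\<Phi> x) (x [^] m)"
proof -
  let ?N = "lower_central R (Suc 0)"
  interpret \<Phi>: group_hom R R \<Phi> using \<Phi> by unfold_locales
  interpret Q: lower_central_quotient R "R Mod ?N" "(#>) ?N" 0 by (rule lower_central_quotient_coset)
  obtain k :: nat where k: "k \<ge> 1" "x [^] k \<in> A" using x dense unfolding isolator_def by blast
  let ?y = "\<Phi> x \<otimes> inv (x [^] m)"
  have y: "?y \<in> carrier R" using x by simp
  have "lower_central_cong R (Suc 0) (\<Phi> x [^] k) ((x [^] m) [^] k)"
    using power[OF k(2)] x by (simp add: \<Phi>.hom_nat_pow nat_pow_pow mult.commute)
  then have eq: "?N #> (\<Phi> x [^] k) = ?N #> ((x [^] m) [^] k)"
    using x by (simp add: lower_central_coset_eq_iff)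
  have c: "(?N #> \<Phi> x) \<otimes>\<^bsub>R Mod ?N\<^esub> (?N #> inv (x [^] m))
      = (?N #> inv (x [^] m)) \<otimes>\<^bsub>R Mod ?N\<^esub> (?N #> \<Phi> x)"
    by (rule Q.hom_lower_central_central) (use x in simp_all)
  have cl: "\<Phi> x \<in> carrier R" "inv (x [^] m) \<in> carrier R" "x [^] m \<in> carrier R"
    "\<Phi> x [^] k \<in> carrier R" "(x [^] m) [^] k \<in> carrier R" "inv ((x [^] m) [^] k) \<in> carrier R"
    using x by simp_all
  have "?N #> (?y [^] k) = ((?N #> \<Phi> x) \<otimes>\<^bsub>R Mod ?N\<^esub> (?N #> inv (x [^] m))) [^]\<^bsub>R Mod ?N\<^esub> k"
    using y cl(1,2) by (simp only: Q.hom_nat_pow Q.hom_mult)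
  also have "\<dots> = (?N #> (\<Phi> x [^] k)) \<otimes>\<^bsub>R Mod ?N\<^esub> (?N #> (inv (x [^] m) [^] k))"
    using Q.H.pow_mult_distrib[OF c] cl by (simp only: Q.hom_nat_pow Q.hom_closed)
  also have "\<dots> = (?N #> ((x [^] m) [^] k)) \<otimes>\<^bsub>R Mod ?N\<^esub> (?N #> inv ((x [^] m) [^] k))"
    using cl by (simp only: eq nat_pow_inv)
  also have "\<dots> = ?N #> \<one>" using cl by (simp only: Q.hom_mult[symmetric] r_inv)
  finally have "?y [^] k \<in> ?N"
    using y lower_central_coset_eq_iff[of "?y [^] k" \<one> "Suc 0"] by (simp add: lower_central_cong_def)
  then show ?thesis
    using lower_central_isolated[OF _ y k(1)] by (simp add: lower_central_cong_def)
qed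

text \<open>If \<open>x\<close> has weight \<open>n + 1\<close> and \<open>x\<^sup>k\<close> lies in \<open>A\<close>, then the endomorphism for \<open>m = k\<close> maps \<open>x\<close> to
  an element of \<open>A\<close> times an element of weight \<open>n + 2\<close>, which a further endomorphism takes care of.\<close>

lemma injective_endomorphism_into_subgroup:
  assumes A: "subgroup A R" and dense: "isolator R A = carrier R"
    and powers: "\<And>m::nat. m \<ge> 1 \<Longrightarrow> \<exists>\<Phi>\<in>hom R R. \<Phi> ` A \<subseteq> A \<and>
      (\<forall>x\<in>carrier R. lower_central_cong R 1 (\<Phi> x) (x [^] m))"
    and "x \<in> carrier R"
  shows "\<exists>\<Phi>\<in>hom R R. inj_on \<Phi> (carrier R) \<and> \<Phi> ` A \<subseteq> A \<and> \<Phi> x \<in> A"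
proof -
  interpret A: subgroup A R by (rule A)
  have Apow: "a [^] i \<in> A" if "a \<in> A" for a and i :: nat using that by (induction i) auto
  obtain s where s: "nilpotent_of_class_le s R" using nilpotent by (auto simp: nilpotent_def)
  \<comment> \<open>Induction on d, a bound for the distance to the class s, while n grows.
    Preservation of \<open>A\<close> belongs to the claim so that endomorphisms can be composed
    without losing what is already in \<open>A\<close>.\<close>
  have "\<exists>\<Phi>\<in>hom R R. inj_on \<Phi> (carrier R) \<and> \<Phi> ` A \<subseteq> A \<and> \<Phi> x \<in> A"
    if "x \<in> lower_central R n" "s \<le> n + d" for n d x
    using that
  proof (induction d arbitrary: n x)
    case 0
    then have "x = \<one>" using lower_central_nilpotent[OF s, of n] by simp
    moreover have "(\<lambda>x. x) \<in> hom R R" by (auto intro: homI)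
    ultimately show ?case by (intro bexI[of _ "\<lambda>x. x"]) auto
  next
    case (Suc d)
    have x: "x \<in> carrier R" using Suc.prems(1) by (rule lower_central_closed)
    obtain k :: nat where k: "k \<ge> 1" "x [^] k \<in> A" using x dense unfolding isolator_def by blast
    obtain \<Phi> where \<Phi>: "\<Phi> \<in> hom R R" "\<Phi> ` A \<subseteq> A"
      "\<And>x. x \<in> carrier R \<Longrightarrow> lower_central_cong R 1 (\<Phi> x) (x [^] k)"
      using powers[OF k(1)] by blast
    have \<Phi>x: "\<Phi> x \<in> carrier R" using \<Phi>(1) x by (rule hom_in_carrier)
    obtain v where v: "v \<in> lower_central R (Suc n)" "\<Phi> x = v \<otimes> x [^] (k ^ Suc n)"
      using power_endomorphism_lower_central[OF \<Phi>(1,3) Suc.prems(1)] lower_central_congE[OF _ \<Phi>x] x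
      by blast
    have "s \<le> Suc n + d" using Suc.prems(2) by simp
    then obtain \<Psi> where \<Psi>: "\<Psi> \<in> hom R R" "inj_on \<Psi> (carrier R)" "\<Psi> ` A \<subseteq> A" "\<Psi> v \<in> A"
      using Suc.IH[OF v(1)] by blast
    \<comment> \<open>The exponent contains at least one factor k, and \<open>x [^] k\<close> is in
      \<open>A\<close>.\<close>
    have xA: "x [^] (k ^ Suc n) \<in> A" using Apow[OF k(2), of "k ^ n"] x by (simp add: nat_pow_pow)
    have "\<Psi> (\<Phi> x) = \<Psi> v \<otimes> \<Psi> (x [^] (k ^ Suc n))"
      unfolding v(2) using lower_central_closed[OF v(1)] x by (intro hom_mult[OF \<Psi>(1)]) auto
    then have "(\<Psi> \<circ> \<Phi>) x \<in> A" using \<Psi>(3,4) xA by (auto intro!: A.m_closed)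
    moreover have "\<Psi> \<circ> \<Phi> \<in> hom R R" using Group.hom_compose[OF \<Phi>(1) \<Psi>(1)] by (simp add: o_def)
    moreover have "inj_on (\<Psi> \<circ> \<Phi>) (carrier R)"
      using power_endomorphism_inj[OF \<Phi>(1,3) k(1)] \<Psi>(2) hom_in_carrier[OF \<Phi>(1)]
      by (auto intro!: comp_inj_on inj_on_subset[OF \<Psi>(2)])
    moreover have "(\<Psi> \<circ> \<Phi>) ` A \<subseteq> A" using \<Phi>(2) \<Psi>(3) by (simp add: image_subset_iff)
    ultimately show ?case by blast
  qed
  from this[of x 0 s] show ?thesis using assms(4) by simp
qed

text \<open>The points are absorbed one at a time; those already moved into \<open>A\<close> stay
  there because each later endomorphism preserves \<open>A\<close>.\<close>

lemma injective_endomorphism_into_subgroup_finite: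
  assumes A: "subgroup A R" and dense: "isolator R A = carrier R"
    and powers: "\<And>m::nat. m \<ge> 1 \<Longrightarrow> \<exists>\<Phi>\<in>hom R R. \<Phi> ` A \<subseteq> A \<and>
      (\<forall>x\<in>carrier R. lower_central_cong R 1 (\<Phi> x) (x [^] m))"
    and "finite B" "B \<subseteq> carrier R"
  shows "\<exists>\<Phi>\<in>hom R R. inj_on \<Phi> (carrier R) \<and> \<Phi> ` A \<subseteq> A \<and> \<Phi> ` B \<subseteq> A"
  using assms(4,5)
proof (induction B rule: finite_induct)
  case empty
  have "(\<lambda>x. x) \<in> hom R R" by (auto intro: homI)
  then show ?case by (intro bexI[of _ "\<lambda>x. x"]) auto
next
  case (insert b B)
  have "B \<subseteq> carrier R" using insert.prems by simp
  from insert.IH[OF this]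
  obtain \<Phi> where \<Phi>: "\<Phi> \<in> hom R R" "inj_on \<Phi> (carrier R)" "\<Phi> ` A \<subseteq> A" "\<Phi> ` B \<subseteq> A"
    by (elim bexE conjE)
  have "\<Phi> b \<in> carrier R" using insert.prems hom_in_carrier[OF \<Phi>(1)] by blast
  from injective_endomorphism_into_subgroup[OF A dense powers this]
  obtain \<Psi> where \<Psi>: "\<Psi> \<in> hom R R" "inj_on \<Psi> (carrier R)" "\<Psi> ` A \<subseteq> A" "\<Psi> (\<Phi> b) \<in> A"
    by blast
  have "\<Psi> \<circ> \<Phi> \<in> hom R R" using Group.hom_compose[OF \<Phi>(1) \<Psi>(1)] by (simp add: o_def)
  moreover have "inj_on (\<Psi> \<circ> \<Phi>) (carrier R)"
    using hom_in_carrier[OF \<Phi>(1)] by (auto intro!: comp_inj_on \<Phi>(2) inj_on_subset[OF \<Psi>(2)])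
  moreover have "(\<Psi> \<circ> \<Phi>) ` A \<subseteq> A" "(\<Psi> \<circ> \<Phi>) ` insert b B \<subseteq> A"
    using \<Phi>(3,4) \<Psi>(3,4) by (simp_all add: image_subset_iff)
  ultimately show ?case by blast
qed

end

section \<open>Relatively free groups\<close>

lemma variety_gen_closed:
  assumes "laws V" "x \<in> X"
  shows "variety_gen V X x \<in> carrier (variety_free V X)"
  using hom_in_carrier[OF normal.r_coset_hom_Mod[OF verbal_normal[OF assms(1) group_free_group]]
      gen_in_carrier[OF assms(2)]]
  by (simp add: variety_gen_def variety_free_def)

lemma variety_free_hom_eqI:
  assumes "laws V" "in_variety V H" "\<phi> \<in> hom (variety_free V X) H" "\<psi> \<in> hom (variety_free V X) H"
    and "\<And>x. x \<in> X \<Longrightarrow> \<phi> (variety_gen V X x) = \<psi> (variety_gen V X x)"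
    and "w \<in> carrier (variety_free V X)"
  shows "\<phi> w = \<psi> w"
proof -
  have "(\<lambda>x. \<psi> (variety_gen V X x)) \<in> X \<rightarrow> carrier H"
    using hom_in_carrier[OF assms(4) variety_gen_closed[OF assms(1)]] by blast
  from variety_free_universal[OF assms(1,2) this] obtain \<chi> where
    "\<forall>\<phi>\<in>hom (variety_free V X) H. (\<forall>x\<in>X. \<phi> (variety_gen V X x) = \<psi> (variety_gen V X x)) \<longrightarrow>
       (\<forall>w\<in>carrier (variety_free V X). \<phi> w = \<chi> w)"
    by (elim bexE conjE)
  then have "\<phi> w = \<chi> w" and "\<psi> w = \<chi> w" using assms(3-6) by blast+
  then show ?thesis by simp
qed

text \<open>Modulo the derived subgroup the m-th power is a homomorphism, and it agrees there with
  \<phi> on the free generators. Both maps are pulled back to the absolute free group, where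
  uniqueness holds for homomorphisms into any group, in particular into the abelianization.\<close>

lemma variety_free_power_endomorphism:
  fixes X :: "'x set" and m :: nat
  assumes "laws V"
  shows "\<exists>\<phi>\<in>hom (variety_free V X) (variety_free V X). \<forall>x\<in>carrier (variety_free V X).
    lower_central_cong (variety_free V X) 1 (\<phi> x) (x [^]\<^bsub>variety_free V X\<^esub> m)"
proof -
  let ?W = "free_group X" and ?V = "verbal_subgroup V (free_group X)" and ?F = "variety_free V X"
  interpret F: group ?F by (rule variety_free_group[OF assms])
  interpret W: group ?W by (rule group_free_group)
  have V: "?V \<lhd> ?W" by (rule verbal_normal[OF assms group_free_group])
  interpret c: group_hom ?W ?F "(#>\<^bsub>?W\<^esub>) ?V"
    unfolding variety_free_def by (rule W.group_hom_coset[OF V])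
  note gen = variety_gen_closed[OF assms]
  have f: "(\<lambda>x. variety_gen V X x [^]\<^bsub>?F\<^esub> m) \<in> X \<rightarrow> carrier ?F"
    by (intro funcsetI F.nat_pow_closed gen)
  from variety_free_universal[OF assms variety_free_in_variety[OF assms] f]
  obtain \<phi> where \<phi>: "\<phi> \<in> hom ?F ?F"
    "\<And>x. x \<in> X \<Longrightarrow> \<phi> (variety_gen V X x) = variety_gen V X x [^]\<^bsub>?F\<^esub> m"
    by (elim bexE conjE) (rule that, assumption, erule (1) bspec)
  let ?N = "lower_central ?F (Suc 0)"
  let ?Q = "?F Mod ?N"
  interpret Q: lower_central_quotient ?F ?Q "(#>\<^bsub>?F\<^esub>) ?N" 0
    by (rule F.lower_central_quotient_coset)
  interpret \<phi>: group_hom ?F ?F \<phi> using \<phi>(1) by unfold_locales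
  let ?g = "\<lambda>x. (?N #>\<^bsub>?F\<^esub> variety_gen V X x) [^]\<^bsub>?Q\<^esub> m"
  have g: "?g \<in> X \<rightarrow> carrier ?Q" by (intro funcsetI Q.H.nat_pow_closed Q.hom_closed gen)
  have 1: "(\<lambda>w. ?N #>\<^bsub>?F\<^esub> \<phi> (?V #>\<^bsub>?W\<^esub> w)) \<in> hom ?W ?Q"
    by (rule homI) (simp_all only: c.hom_mult \<phi>.hom_mult Q.hom_mult c.hom_closed \<phi>.hom_closed Q.hom_closed)
  have 2: "(\<lambda>w. (?N #>\<^bsub>?F\<^esub> (?V #>\<^bsub>?W\<^esub> w)) [^]\<^bsub>?Q\<^esub> m) \<in> hom ?W ?Q"
  proof (rule homI)
    fix u v assume uv: "u \<in> carrier ?W" "v \<in> carrier ?W"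
    then have "?V #>\<^bsub>?W\<^esub> u \<in> lower_central ?F 0" "?V #>\<^bsub>?W\<^esub> v \<in> carrier ?F" by simp_all
    from Q.H.pow_mult_distrib[OF Q.hom_lower_central_central[OF this], of m]
    show "(?N #>\<^bsub>?F\<^esub> (?V #>\<^bsub>?W\<^esub> (u \<otimes>\<^bsub>?W\<^esub> v))) [^]\<^bsub>?Q\<^esub> m
        = (?N #>\<^bsub>?F\<^esub> (?V #>\<^bsub>?W\<^esub> u)) [^]\<^bsub>?Q\<^esub> m \<otimes>\<^bsub>?Q\<^esub> (?N #>\<^bsub>?F\<^esub> (?V #>\<^bsub>?W\<^esub> v)) [^]\<^bsub>?Q\<^esub> m"
      using uv by (simp only: c.hom_mult Q.hom_mult c.hom_closed Q.hom_closed)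
  qed (simp only: c.hom_closed Q.hom_closed Q.H.nat_pow_closed)
  have "lower_central_cong ?F 1 (\<phi> x) (x [^]\<^bsub>?F\<^esub> m)" if x: "x \<in> carrier ?F" for x
  proof -
    obtain w where w: "w \<in> carrier ?W" "x = ?V #>\<^bsub>?W\<^esub> w"
      using x by (auto simp: variety_free_def carrier_FactGroup)
    have "?N #>\<^bsub>?F\<^esub> \<phi> (?V #>\<^bsub>?W\<^esub> gen y) = ?g y" if "y \<in> X" for y
      using \<phi>(2)[OF that] gen[OF that] Q.hom_nat_pow by (simp only: variety_gen_def)
    from free_group_hom_unique[OF Q.H.is_group g 1 this w(1)]
    have "?N #>\<^bsub>?F\<^esub> \<phi> x = word_value ?Q ?g w" by (simp only: w(2))
    also have "\<dots> = (?N #>\<^bsub>?F\<^esub> x) [^]\<^bsub>?Q\<^esub> m"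
      using free_group_hom_unique[OF Q.H.is_group g 2 _ w(1)] by (simp add: w(2) variety_gen_def)
    also have "\<dots> = ?N #>\<^bsub>?F\<^esub> (x [^]\<^bsub>?F\<^esub> m)" using x by (simp only: Q.hom_nat_pow)
    finally show ?thesis using x by (simp add: F.lower_central_coset_eq_iff)
  qed
  then show ?thesis using \<phi>(1) by blast
qed

lemma relatively_free_power_endomorphism:
  fixes m :: nat
  assumes "group G" "relatively_free G"
  shows "\<exists>\<phi>\<in>hom G G. \<forall>x\<in>carrier G. lower_central_cong G 1 (\<phi> x) (x [^]\<^bsub>G\<^esub> m)"
proof -
  interpret G: group G by fact
  obtain V and X :: "'a set" where V: "laws V" "G \<cong> variety_free V X"
    using assms(2) unfolding relatively_free_def by blast
  let ?F = "variety_free V X"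
  interpret F: group ?F by (rule variety_free_group[OF V(1)])
  obtain h where h: "h \<in> iso G ?F" using V(2) by (auto simp: is_iso_def)
  let ?k = "inv_into (carrier G) h"
  have k: "?k \<in> iso ?F G" by (rule G.iso_set_sym[OF h])
  obtain \<phi> where \<phi>: "\<phi> \<in> hom ?F ?F"
    "\<And>x. x \<in> carrier ?F \<Longrightarrow> lower_central_cong ?F 1 (\<phi> x) (x [^]\<^bsub>?F\<^esub> m)"
    using variety_free_power_endomorphism[OF V(1)] by blast
  interpret h: group_hom G ?F h using h by unfold_locales (simp add: iso_def)
  interpret k: group_hom ?F G ?k using k by unfold_locales (simp add: iso_def)
  interpret \<phi>: group_hom ?F ?F \<phi> using \<phi>(1) by unfold_locales
  have kh: "?k (h x) = x" if "x \<in> carrier G" for x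
    using h that by (simp add: iso_def bij_betw_def)
  have "(\<lambda>x. ?k (\<phi> (h x))) \<in> hom G G" by (rule homI) simp_all
  moreover have "lower_central_cong G 1 (?k (\<phi> (h x))) (x [^]\<^bsub>G\<^esub> m)" if x: "x \<in> carrier G" for x
    using k.lower_central_cong_hom[OF \<phi>(2)[of "h x"]] x kh[of x] by (simp add: k.hom_nat_pow)
  ultimately show ?thesis by (intro bexI[of _ "\<lambda>x. ?k (\<phi> (h x))"]) blast+
qed

section \<open>Geometric equivalence\<close>

text \<open>Each point in one group has a counterpart in the other with the same kernel, so both
  closures are intersections of the same kernels. The embedding \<Phi> may depend on the point,
  because only the finitely many images of the generators have to be absorbed.\<close>

lemma alg_closure_eqI_embedding:
  assumes "group G" "group R" "\<iota> \<in> mon G R" and \<Theta>: "laws \<Theta>" "in_variety \<Theta> G" "in_variety \<Theta> R"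
    and absorb: "\<And>B. finite B \<Longrightarrow> B \<subseteq> carrier R \<Longrightarrow>
      \<exists>\<Phi>\<in>hom R R. inj_on \<Phi> (carrier R) \<and> \<Phi> ` B \<subseteq> \<iota> ` carrier G"
    and Y: "finite Y"
  shows "alg_closure \<Theta> Y T G = alg_closure \<Theta> Y T R"
proof
  let ?W = "variety_free \<Theta> Y"
  interpret W: group ?W by (rule variety_free_group[OF \<Theta>(1)])
  have \<iota>: "\<iota> \<in> hom G R" "inj_on \<iota> (carrier G)" using assms(3) by (auto simp: mon_def)
  interpret \<iota>: group_hom G R \<iota>
    using assms(1,2) \<iota>(1) by (simp add: group_hom_def group_hom_axioms_def)
  have \<iota>1: "\<iota> x = \<one>\<^bsub>R\<^esub> \<longleftrightarrow> x = \<one>\<^bsub>G\<^esub>" if "x \<in> carrier G" for x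
    using \<iota>(2) that \<iota>.inj_on_one_iff by auto
  show "alg_closure \<Theta> Y T R \<subseteq> alg_closure \<Theta> Y T G"
    unfolding alg_closure_def
  proof (rule INT_greatest)
    fix \<mu> assume \<mu>: "\<mu> \<in> alg_points \<Theta> Y T G"
    then have \<mu>h: "\<mu> \<in> hom ?W G" by (simp add: alg_points_def)
    have ker: "kernel ?W R (\<iota> \<circ> \<mu>) = kernel ?W G \<mu>"
      using \<iota>1 hom_in_carrier[OF \<mu>h] by (auto simp: kernel_def)
    have "\<iota> \<circ> \<mu> \<in> hom ?W R" using Group.hom_compose[OF \<mu>h \<iota>(1)] by (simp add: o_def)
    then have "\<iota> \<circ> \<mu> \<in> alg_points \<Theta> Y T R" using \<mu> ker by (simp add: alg_points_def)
    then show "(\<Inter>\<mu>\<in>alg_points \<Theta> Y T R. kernel ?W R \<mu>) \<subseteq> kernel ?W G \<mu>" using ker by blast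
  qed
  show "alg_closure \<Theta> Y T G \<subseteq> alg_closure \<Theta> Y T R"
    unfolding alg_closure_def
  proof (rule INT_greatest)
    fix \<mu> assume \<mu>: "\<mu> \<in> alg_points \<Theta> Y T R"
    then have \<mu>h: "\<mu> \<in> hom ?W R" by (simp add: alg_points_def)
    let ?B = "(\<lambda>y. \<mu> (variety_gen \<Theta> Y y)) ` Y"
    have "?B \<subseteq> carrier R"
      by (intro image_subsetI hom_in_carrier[OF \<mu>h] variety_gen_closed[OF \<Theta>(1)])
    from absorb[OF finite_imageI[OF Y] this]
    obtain \<Phi> where \<Phi>: "\<Phi> \<in> hom R R" "inj_on \<Phi> (carrier R)" "\<Phi> ` ?B \<subseteq> \<iota> ` carrier G"
      by (elim bexE conjE)
    interpret \<Phi>: group_hom R R \<Phi>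
      using assms(2) \<Phi>(1) by (simp add: group_hom_def group_hom_axioms_def)
    have \<Phi>1: "\<Phi> x = \<one>\<^bsub>R\<^esub> \<longleftrightarrow> x = \<one>\<^bsub>R\<^esub>" if "x \<in> carrier R" for x
      using \<Phi>(2) that \<Phi>.inj_on_one_iff by auto
    have "\<exists>g\<in>carrier G. \<iota> g = \<Phi> (\<mu> (variety_gen \<Theta> Y y))" if "y \<in> Y" for y
      using \<Phi>(3) that by fastforce
    then obtain f where f: "\<And>y. y \<in> Y \<Longrightarrow> f y \<in> carrier G"
      "\<And>y. y \<in> Y \<Longrightarrow> \<iota> (f y) = \<Phi> (\<mu> (variety_gen \<Theta> Y y))" by metis
    \<comment> \<open>The counterpart \<nu> comes from the universal property in G. It satisfies
      \<iota> \<circ> \<nu> = \<Phi> \<circ> \<mu> on generators, hence on the carrier, and both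
      \<iota> and \<Phi> are injective, so the kernels coincide.\<close>
    then have "f \<in> Y \<rightarrow> carrier G" by blast
    from variety_free_universal[OF \<Theta>(1,2) this]
    obtain \<nu> where \<nu>: "\<nu> \<in> hom ?W G" "\<And>y. y \<in> Y \<Longrightarrow> \<nu> (variety_gen \<Theta> Y y) = f y" by blast
    have \<iota>\<nu>: "\<iota> \<circ> \<nu> \<in> hom ?W R" using Group.hom_compose[OF \<nu>(1) \<iota>(1)] by (simp add: o_def)
    have \<Phi>\<mu>: "\<Phi> \<circ> \<mu> \<in> hom ?W R" using Group.hom_compose[OF \<mu>h \<Phi>(1)] by (simp add: o_def)
    have "\<nu> w = \<one>\<^bsub>G\<^esub> \<longleftrightarrow> \<mu> w = \<one>\<^bsub>R\<^esub>" if w: "w \<in> carrier ?W" for w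
    proof -
      have "\<iota> (\<nu> w) = \<Phi> (\<mu> w)"
        using variety_free_hom_eqI[OF \<Theta>(1,3) \<iota>\<nu> \<Phi>\<mu> _ w] \<nu>(2) f(2) by simp
      then show ?thesis
        using \<iota>1[OF hom_in_carrier[OF \<nu>(1) w]] \<Phi>1[OF hom_in_carrier[OF \<mu>h w]] by simp
    qed
    then have ker: "kernel ?W G \<nu> = kernel ?W R \<mu>" by (auto simp: kernel_def)
    then have "\<nu> \<in> alg_points \<Theta> Y T G" using \<mu> \<nu>(1) by (simp add: alg_points_def)
    then show "(\<Inter>\<mu>\<in>alg_points \<Theta> Y T G. kernel ?W G \<mu>) \<subseteq> kernel ?W R \<mu>" using ker by blast
  qed
qed

theorem theorem2:
  fixes G :: "'a monoid" and R :: "'b monoid" and \<iota> :: "'a \<Rightarrow> 'b" and \<Theta> :: "nat word set"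
  assumes "group G" and "torsion_free G" and "nilpotent G" and "relatively_free G"
    and "maltsev_completion G R \<iota>"
    and "laws \<Theta>" and "in_variety \<Theta> G" and "in_variety \<Theta> R"
  shows "geometrically_equivalent \<Theta> G R"
proof -
  interpret G: group G by fact
  have \<iota>: "\<iota> \<in> mon G R" and "torsion_free_nilpotent_with_roots R"
    using assms(5) by (simp_all add: maltsev_completion_def)
  then interpret R: nilpotent_with_roots R by (intro nilpotent_with_rootsI)
  have \<iota>h: "\<iota> \<in> hom G R" "inj_on \<iota> (carrier G)" using \<iota> by (auto simp: mon_def)
  interpret \<iota>: group_hom G R \<iota> using \<iota>h(1) by unfold_locales
  let ?A = "\<iota> ` carrier G"
  have dense: "isolator R ?A = carrier R" by (rule maltsev_completion_dense[OF assms(1,5)])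
  have powers: "\<exists>\<Phi>\<in>hom R R. \<Phi> ` ?A \<subseteq> ?A \<and>
      (\<forall>x\<in>carrier R. lower_central_cong R 1 (\<Phi> x) (x [^]\<^bsub>R\<^esub> m))" for m :: nat
  proof -
    obtain \<phi> where \<phi>: "\<phi> \<in> hom G G"
      "\<And>x. x \<in> carrier G \<Longrightarrow> lower_central_cong G 1 (\<phi> x) (x [^]\<^bsub>G\<^esub> m)"
      using relatively_free_power_endomorphism[OF assms(1,4)] by blast
    have "\<iota> \<circ> \<phi> \<in> hom G R" using Group.hom_compose[OF \<phi>(1) \<iota>h(1)] by (simp add: o_def)
    from R.extend_hom[OF assms(1) \<iota>h this dense, unfolded o_def]
    obtain \<Phi> where \<Phi>: "\<Phi> \<in> hom R R" "\<And>g. g \<in> carrier G \<Longrightarrow> \<Phi> (\<iota> g) = \<iota> (\<phi> g)"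
      by (elim bexE) (rule that, assumption, erule (1) bspec)
    \<comment> \<open>The congruence is known for \<phi> in G, so \<iota> first carries it to the
      image of G only; from there it spreads because every element of R has a power in that
      image.\<close>
    have "lower_central_cong R 1 (\<Phi> x) (x [^]\<^bsub>R\<^esub> m)" if "x \<in> ?A" for x
      using that
    proof (rule imageE)
      fix g assume g: "x = \<iota> g" "g \<in> carrier G"
      then show ?thesis
        using \<iota>.lower_central_cong_hom[OF \<phi>(2)[OF g(2)]] hom_in_carrier[OF \<phi>(1) g(2)] \<Phi>(2)[OF g(2)]
        by (simp add: \<iota>.hom_nat_pow)
    qed
    from R.power_endomorphism_extend[OF \<Phi>(1) dense this]
    have "\<forall>x\<in>carrier R. lower_central_cong R 1 (\<Phi> x) (x [^]\<^bsub>R\<^esub> m)" by blast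
    moreover have "\<Phi> ` ?A \<subseteq> ?A" using \<Phi>(2) hom_in_carrier[OF \<phi>(1)] by auto
    ultimately show ?thesis using \<Phi>(1) by blast
  qed
  have absorb: "\<exists>\<Phi>\<in>hom R R. inj_on \<Phi> (carrier R) \<and> \<Phi> ` B \<subseteq> ?A"
    if "finite B" "B \<subseteq> carrier R" for B
    using R.injective_endomorphism_into_subgroup_finite[OF \<iota>.img_is_subgroup dense powers that] by blast
  show ?thesis
    unfolding geometrically_equivalent_def
    using alg_closure_eqI_embedding[OF assms(1) R.is_group \<iota> assms(6-8) absorb] assms(7,8) by blast
qed

end
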